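(* Consider the box-ball system with box capacities $\Delta_n$ and carrier capacity $M_{t+1}$ from time $t$ to time $t+1$, whose state at time $t$ has $N\ge 1$ solitons. Let $Q^{(t)}_n,E^{(t)}_n$ be the sizes of the $n$th soliton and the $n$th empty block at time $t$, let $\overline Q^{(t+1)}_n,\overline E^{(t+1)}_n$ be the sizes of the $n$th soliton and the $n$th empty block after the size limit process from time $t$ to $t+1$, let $\overline C^{(t+1)}_n,\overline D^{(t+1)}_n$ be the carrier quantities defined in the context, and let $K^{(t)}_n$, $\Lambda^{(t)}_n$ be the capacities of the boxes containing the leftmost segment of the $n$th soliton, respectively of the $n$th empty block, at time $t$. Suppose that the carrier capacity is chosen to satisfy $K^{(t)}_n\le M_{t+1}$ for all $n$ and $t$. Then the time evolution of the box-ball system is given by $$\overline Q^{(t+1)}_n=\min\left(E^{(t)}_{n+1}-\max(0,\Lambda^{(t)}_{n+1}-\overline D^{(t+1)}_n),\ \overline D^{(t+1)}_n\right),\qquad 0\le n\le N-1,$$ $$\overline E^{(t+1)}_n=E^{(t)}_n-\overline Q^{(t+1)}_{n-1}+Q^{(t)}_n-\max(0,\Lambda^{(t)}_n-\overline D^{(t+1)}_{n-1})+\max(0,\Lambda^{(t)}_{n+1}-\overline D^{(t+1)}_n),\qquad 1\le n\le N-1,$$ $$\overline C^{(t+1)}_n=\min(\overline D^{(t+1)}_{n-1}-\overline Q^{(t+1)}_{n-1}+K^{(t)}_n,\ M_{t+1}),\qquad 1\le n\le N,$$ $$\overline D^{(t+1)}_n=\min(\overline C^{(t+1)}_n+Q^{(t)}_n-K^{(t)}_n,\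 M_{t+1}),\qquad 0\le n\le N-1,$$ $$Q^{(t+1)}_n=Q^{(t)}_n+\overline C^{(t+1)}_n-\overline C^{(t+1)}_{n+1}-K^{(t)}_n+K^{(t)}_{n+1},\qquad 0\le n\le N-1,$$ $$E^{(t+1)}_n=\overline E^{(t+1)}_n+\overline Q^{(t+1)}_{n-1}-Q^{(t)}_n-\overline D^{(t+1)}_{n-1}+\overline D^{(t+1)}_n,\qquad 1\le n\le N-1,$$ $$E^{(t)}_0=E^{(t)}_N=\overline E^{(t)}_0=\overline E^{(t)}_N=+\infty,\qquad \overline C^{(t+1)}_0=K^{(t)}_0.$$ That is, the state after the size limit process and the state at time $t+1$ again have $N$ solitons, and the sizes of their solitons and empty blocks, together with the carrier quantities, satisfy these equations.
   Context: **Box-ball system with a carrier.** Boxes are indexed by $n\in\mathbb Z$; the $n$th box has capacity $\Delta_n$, a positive integer. The carrier capacity from time $t$ to $t+1$ is $M_{t+1}$, a nonnegative integer or $+\infty$. A state at time $t$ is a sequence $(U^{(t)}_n)_{n\in\mathbb Z}$ with $U^{(t)}_n\in\{0,1,\dots,\Delta_n\}$ (the number of balls in the $n$th box); there are finitely many balls, and $U^{(t)}_n=0$ for $n<0$. The evolution from $t$ to $t+1$ is the composition of two processes. *Size limit process:* a carrier moves from $n=-\infty$ to $n=+\infty$. At each box it gets all balls in the box; if the number of balls then exceeds $M_{t+1}$, the excess balls are removed from the system; at the same time the carrier puts as many as possible of the balls it holds (on arrival) into the box. With $\overline U^{(t+1)}_n$ the number of balls in the $n$th box after this process and $\overline Z^{(t+1)}_n$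 the number of balls in the carrier on arrival at the $n$th box (zero for $n\le 0$), $$\overline U^{(t+1)}_n=\min(\Delta_n-U^{(t)}_n,\overline Z^{(t+1)}_n),\qquad \overline Z^{(t+1)}_n=\min(\overline Z^{(t+1)}_{n-1}+U^{(t)}_{n-1},M_{t+1})-\overline U^{(t+1)}_{n-1}.$$ *Recovery process:* all removed balls are returned to the boxes in which they were, i.e. $$U^{(t+1)}_n=U^{(t)}_n+\overline Z^{(t+1)}_n-\overline Z^{(t+1)}_{n+1}.$$ **Expansion map.** Let $s_0=0$ and $s_n=\sum_{j=0}^{n-1}\Delta_j$ for $n\ge1$. A state $(U_n)$ with $0\le U_n\le\Delta_n$ and $U_n=0$ for $n<0$ is mapped to a binary sequence $(V_j)_{j\in\mathbb Z}$ as follows. Set $V_j=0$ for $j<0$. Then, for $n=0,1,2,\dots$ successively: if $V_{s_n-1}=1$, set $V_j=1$ for $s_n\le j\le s_n+U_n-1$ and $V_j=0$ for $s_n+U_n\le j\le s_n+\Delta_n-1$; otherwise set $V_j=0$ for $s_n\le j\le s_n+\Delta_n-U_n-1$ and $V_j=1$ for $s_n+\Delta_n-U_n\le j\le s_n+\Delta_n-1$. The entry $V_j$ is called the $j$th segment; the $n$th box ($n\ge0$) contains the segments $s_n,\dots,s_n+\Delta_n-1$. **Solitons and empty blocks.** The solitons of a state are the maximal runs of consecutive $1$s of its binary sequence, numbered $0,1,\dots,N-1$ from left to right; the size of a soliton is its length. For $1\le n\le N-1$ the $n$th empty block is the run of $0$s between the $(n-1)$th and $n$th solitons, its size being its length;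 the $0$th and $N$th empty blocks are the infinite runs of $0$s to the left of all solitons and to the right of all solitons, with size $+\infty$. $Q^{(t)}_n,E^{(t)}_n$ are the sizes for the state $(U^{(t)}_n)$, and $\overline Q^{(t+1)}_n,\overline E^{(t+1)}_n$ are the sizes for the state $(\overline U^{(t+1)}_n)$. **Capacities.** For $0\le n\le N-1$, $K^{(t)}_n$ is the capacity of the box which contains the leftmost segment of the $n$th soliton at time $t$; for $1\le n\le N$, $\Lambda^{(t)}_n$ is the capacity of the box which contains the leftmost segment of the $n$th empty block at time $t$. (The symbol $K^{(t)}_N$ occurring in the equations may be taken to be any number with $K^{(t)}_N\le M_{t+1}$.) **Carrier quantities.** For $0\le n\le N-1$, $\overline D^{(t+1)}_n$ is the number of balls which the carrier holds, in the size limit process, after getting the $Q^{(t)}_n$ balls of the $n$th soliton and restricting the number of held balls to $M_{t+1}$: $\overline D^{(t+1)}_n=\min(\overline Z^{(t+1)}_m+U^{(t)}_m,M_{t+1})$, where $m$ is the index of the box containing the leftmost segment of the $(n+1)$th empty block at time $t$. For $1\le n\le N-1$: if $\overline D^{(t+1)}_{n-1}-\overline Q^{(t+1)}_{n-1}>0$, then $\overline C^{(t+1)}_n$ is the number of balls which the carrier holds after getting the $U^{(t)}_m$ balls of box $m$ and restricting the number of held balls to $M_{t+1}$, i.e. $\overline C^{(t+1)}_n=\min(\overline Z^{(t+1)}_m+U^{(t)}_m,M_{t+1})$, where $m$ is now the index of the box containing the leftmost segment of the $n$th soliton at time $t$; if $\overline D^{(t+1)}_{n-1}-\overline Q^{(t+1)}_{n-1}=0$,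 then $\overline C^{(t+1)}_n=K^{(t)}_n$. Moreover $\overline C^{(t+1)}_0=K^{(t)}_0$ and $\overline C^{(t+1)}_N=K^{(t)}_N$.
   Formalization: As stated the claim fails when an empty block starts in a box of capacity Λ > M_{t+1}; the equation for Q̄_n is proved when Λ_{n+1} ≤ M_{t+1}, and those for Ē_n and E^{(t+1)}_n when Λ_n, Λ_{n+1} ≤ M_{t+1}; all else is unconditional. *)

theory Defs
  imports Complex_Main "HOL-Library.Extended_Real"
begin

text \<open>Boxes are indexed by the integers; \<^term>\<open>\<Delta> n\<close> is the capacity of box \<^term>\<open>n\<close> and
  \<^term>\<open>u n\<close> the number of balls in it.\<close>

definition bbs_state :: "(int \<Rightarrow> int) \<Rightarrow> (int \<Rightarrow> int) \<Rightarrow> bool" where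
  "bbs_state \<Delta> u \<longleftrightarrow>
     (\<forall>n. 0 \<le> u n \<and> u n \<le> \<Delta> n) \<and> (\<forall>n<0. u n = 0) \<and> finite {n. u n \<noteq> 0}"

text \<open>The minimum of a number of balls and a possibly infinite carrier capacity.\<close>

definition restrict_to :: "enat \<Rightarrow> int \<Rightarrow> int" where
  "restrict_to M x = (case M of enat m \<Rightarrow> min x (int m) | \<infinity> \<Rightarrow> x)"

text \<open>Number of balls in the carrier on arrival at box \<^term>\<open>n\<close>. The subtracted term is
  the content of box \<^term>\<open>n - 1\<close> after the size limit process, cf. \<open>size_limit\<close> below.\<close>

function carrier_load :: "(int \<Rightarrow> int) \<Rightarrow> enat \<Rightarrow> (int \<Rightarrow> int) \<Rightarrow> int \<Rightarrow> int" where
  "carrier_load \<Delta> M u n =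
     (if n \<le> 0 then 0
      else restrict_to M (carrier_load \<Delta> M u (n - 1) + u (n - 1))
             - min (\<Delta> (n - 1) - u (n - 1)) (carrier_load \<Delta> M u (n - 1)))"
  by pat_completeness auto
termination by (relation "measure (\<lambda>(_, _, _, n). nat n)") auto

declare carrier_load.simps [simp del]

definition size_limit :: "(int \<Rightarrow> int) \<Rightarrow> enat \<Rightarrow> (int \<Rightarrow> int) \<Rightarrow> int \<Rightarrow> int" where
  "size_limit \<Delta> M u n = min (\<Delta> n - u n) (carrier_load \<Delta> M u n)"

definition recovery :: "(int \<Rightarrow> int) \<Rightarrow> enat \<Rightarrow> (int \<Rightarrow> int) \<Rightarrow> int \<Rightarrow> int" where
  "recovery \<Delta> M u n = u n + carrier_load \<Delta> M u n - carrier_load \<Delta> M u (n + 1)"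

text \<open>Number of balls held by the carrier after getting the balls of box \<^term>\<open>n\<close> and restricting
  to the capacity, before it puts balls into the box.\<close>

definition carrier_held :: "(int \<Rightarrow> int) \<Rightarrow> enat \<Rightarrow> (int \<Rightarrow> int) \<Rightarrow> int \<Rightarrow> int" where
  "carrier_held \<Delta> M u n = restrict_to M (carrier_load \<Delta> M u n + u n)"

definition seg_start :: "(int \<Rightarrow> int) \<Rightarrow> nat \<Rightarrow> int" where
  "seg_start \<Delta> n = (\<Sum>j<n. \<Delta> (int j))"

definition box_of :: "(int \<Rightarrow> int) \<Rightarrow> int \<Rightarrow> nat" where
  "box_of \<Delta> j = (THE n. seg_start \<Delta> n \<le> j \<and> j < seg_start \<Delta> (Suc n))"

text \<open>\<open>expand_upto \<Delta> u n\<close> is the binary sequence (\<open>True\<close> for 1, \<open>False\<close> for 0) obtained after the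
  segments of the boxes \<open>0, \<dots>, n - 1\<close> have been filled; segments not yet treated are \<open>False\<close>.\<close>

primrec expand_upto :: "(int \<Rightarrow> int) \<Rightarrow> (int \<Rightarrow> int) \<Rightarrow> nat \<Rightarrow> int \<Rightarrow> bool" where
  "expand_upto \<Delta> u 0 = (\<lambda>j. False)"
| "expand_upto \<Delta> u (Suc n) = (\<lambda>j.
     if seg_start \<Delta> n \<le> j \<and> j \<le> seg_start \<Delta> n + \<Delta> (int n) - 1 then
       (if expand_upto \<Delta> u n (seg_start \<Delta> n - 1)
        then j \<le> seg_start \<Delta> n + u (int n) - 1
        else seg_start \<Delta> n + \<Delta> (int n) - u (int n) \<le> j)
     else expand_upto \<Delta> u n j)"

definition expansion :: "(int \<Rightarrow> int) \<Rightarrow> (int \<Rightarrow> int) \<Rightarrow> int \<Rightarrow> bool" where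
  "expansion \<Delta> u j \<longleftrightarrow> 0 \<le> j \<and> expand_upto \<Delta> u (Suc (box_of \<Delta> j)) j"

text \<open>A maximal run of 1s is identified by its leftmost segment.\<close>

definition soliton_starts :: "(int \<Rightarrow> int) \<Rightarrow> (int \<Rightarrow> int) \<Rightarrow> int set" where
  "soliton_starts \<Delta> u = {j. expansion \<Delta> u j \<and> \<not> expansion \<Delta> u (j - 1)}"

definition num_solitons :: "(int \<Rightarrow> int) \<Rightarrow> (int \<Rightarrow> int) \<Rightarrow> nat" where
  "num_solitons \<Delta> u = card (soliton_starts \<Delta> u)"

definition soliton :: "(int \<Rightarrow> int) \<Rightarrow> (int \<Rightarrow> int) \<Rightarrow> nat \<Rightarrow> int set" where
  "soliton \<Delta> u n =
     (let a = sorted_list_of_set (soliton_starts \<Delta> u) ! n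
      in {j. a \<le> j \<and> (\<forall>i\<in>{a..j}. expansion \<Delta> u i)})"

text \<open>Everything strictly between two neighbouring solitons; the blocks with indices \<open>0\<close> and
  \<open>num_solitons \<Delta> u\<close> are unbounded to the left and to the right, respectively.\<close>

definition empty_block :: "(int \<Rightarrow> int) \<Rightarrow> (int \<Rightarrow> int) \<Rightarrow> nat \<Rightarrow> int set" where
  "empty_block \<Delta> u n =
     {j. (0 < n \<longrightarrow> (\<forall>i\<in>soliton \<Delta> u (n - 1). i < j)) \<and>
         (n < num_solitons \<Delta> u \<longrightarrow> (\<forall>i\<in>soliton \<Delta> u n. j < i))}"

definition soliton_size :: "(int \<Rightarrow> int) \<Rightarrow> (int \<Rightarrow> int) \<Rightarrow> nat \<Rightarrow> int" where
  "soliton_size \<Delta> u n = int (card (soliton \<Delta> u n))"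

definition empty_size :: "(int \<Rightarrow> int) \<Rightarrow> (int \<Rightarrow> int) \<Rightarrow> nat \<Rightarrow> ereal" where
  "empty_size \<Delta> u n =
     (if finite (empty_block \<Delta> u n) then ereal (real (card (empty_block \<Delta> u n))) else \<infinity>)"

definition leftmost_box :: "(int \<Rightarrow> int) \<Rightarrow> int set \<Rightarrow> int" where
  "leftmost_box \<Delta> I = int (box_of \<Delta> (LEAST j. j \<in> I))"

text \<open>The argument \<open>\<kappa>\<close> is the conventional value used for the index \<open>num_solitons \<Delta> u\<close>, for which
  there is no soliton.\<close>

definition soliton_cap :: "(int \<Rightarrow> int) \<Rightarrow> int \<Rightarrow> (int \<Rightarrow> int) \<Rightarrow> nat \<Rightarrow> int" where
  "soliton_cap \<Delta> \<kappa> u n =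
     (if n < num_solitons \<Delta> u then \<Delta> (leftmost_box \<Delta> (soliton \<Delta> u n)) else \<kappa>)"

definition empty_cap :: "(int \<Rightarrow> int) \<Rightarrow> (int \<Rightarrow> int) \<Rightarrow> nat \<Rightarrow> int" where
  "empty_cap \<Delta> u n = \<Delta> (leftmost_box \<Delta> (empty_block \<Delta> u n))"

definition carrier_D :: "(int \<Rightarrow> int) \<Rightarrow> enat \<Rightarrow> (int \<Rightarrow> int) \<Rightarrow> nat \<Rightarrow> int" where
  "carrier_D \<Delta> M u n = carrier_held \<Delta> M u (leftmost_box \<Delta> (empty_block \<Delta> u (n + 1)))"

definition carrier_C :: "(int \<Rightarrow> int) \<Rightarrow> enat \<Rightarrow> int \<Rightarrow> (int \<Rightarrow> int) \<Rightarrow> nat \<Rightarrow> int" where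
  "carrier_C \<Delta> M \<kappa> u n =
     (if 1 \<le> n \<and> n < num_solitons \<Delta> u \<and>
         carrier_D \<Delta> M u (n - 1) - soliton_size \<Delta> (size_limit \<Delta> M u) (n - 1) > 0
      then carrier_held \<Delta> M u (leftmost_box \<Delta> (soliton \<Delta> u n))
      else soliton_cap \<Delta> \<kappa> u n)"

end

theory Submission
  imports Defs
begin

text \<open>
  Call a box an up box if it contains the leftmost segment of a soliton, and a down box if it contains
  the leftmost segment of an empty block behind a soliton. A state is a sequence of boxes
  \<open>p 0 < q 0 < p 1 < q 1 < \<dots>\<close>, alternately up and down, with full boxes strictly between \<open>p i\<close> and
  \<open>q i\<close> and empty boxes strictly between \<open>q i\<close> and \<open>p (i + 1)\<close>. Hence sizes of solitons are sums of
  numbers of balls over boxes, and sizes of empty blocks are sums of numbers of vacancies.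

  The carrier gains balls from \<open>p i\<close> to \<open>q i\<close> and releases them from \<open>q i\<close> to \<open>p (i + 1)\<close>; as it has
  room for a full up box, each stretch \<open>p i + 1, \<dots>, p (i + 1)\<close> carries exactly one soliton of either
  new state. The \<open>i\<close>th soliton after the size limit process starts in \<open>q i\<close>. The \<open>i\<close>th soliton after
  recovery starts where balls are first removed in this stretch, or else in \<open>q i\<close>. All equations
  are then telescoping sums along the carrier.
\<close>

section \<open>Partial sums over boxes\<close>

lemma Least_int_atLeastLessThan: "(a::int) < b \<Longrightarrow> (LEAST j. j \<in> {a..<b}) = a"
  by (rule Least_equality) auto

lemma seg_start_0 [simp]: "seg_start f 0 = 0"
  by (simp add: seg_start_def)

lemma seg_start_Suc [simp]: "seg_start f (Suc n) = seg_start f n + f (int n)"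
  by (simp add: seg_start_def)

text \<open>\<open>seg_start\<close> serves as the partial sum of any sequence: of \<open>u\<close>
  it counts balls, of \<open>\<Delta>\<close> segments, and the difference of the two counts
  vacancies. With \<open>f = u\<close> and \<open>g = \<Delta>\<close> this rule trades balls for
  segments across full boxes; \<open>seg_start_const\<close> skips empty boxes.\<close>

lemma seg_start_diff_cong:
  assumes "a \<le> b" and "\<And>n. a \<le> n \<Longrightarrow> n < b \<Longrightarrow> f (int n) = g (int n)"
  shows "seg_start f b - seg_start f a = seg_start g b - seg_start g a"
  using assms by (induction b rule: dec_induct) (simp_all add: algebra_simps)

lemma seg_start_const:
  assumes "a \<le> b" and "\<And>n. a \<le> n \<Longrightarrow> n < b \<Longrightarrow> f (int n) = 0"
  shows "seg_start f b = seg_start f a"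
  using assms by (induction b rule: dec_induct) simp_all

section \<open>Boxes and their segments\<close>

locale boxes =
  fixes \<Delta> :: "int \<Rightarrow> int"
  assumes cap_pos: "0 < \<Delta> n"
begin

lemma seg_start_strict_mono: "m < n \<Longrightarrow> seg_start \<Delta> m < seg_start \<Delta> n"
  by (rule lift_Suc_mono_less[of "seg_start \<Delta>"]) (simp_all add: cap_pos)

lemma seg_start_mono: "m \<le> n \<Longrightarrow> seg_start \<Delta> m \<le> seg_start \<Delta> n"
  using seg_start_strict_mono by (metis le_less)

lemma seg_start_nonneg: "0 \<le> seg_start \<Delta> n"
  using seg_start_mono[of 0 n] by simp

lemma box_unique:
  assumes "seg_start \<Delta> m \<le> j" "j < seg_start \<Delta> (Suc m)"
    and "seg_start \<Delta> n \<le> j" "j < seg_start \<Delta> (Suc n)"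
  shows "m = n"
proof (rule ccontr)
  assume "m \<noteq> n"
  then have "Suc m \<le> n \<or> Suc n \<le> m" by auto
  then show False
    using seg_start_mono[of "Suc m" n] seg_start_mono[of "Suc n" m] assms by linarith
qed

lemma box_of_eq:
  assumes "seg_start \<Delta> n \<le> j" "j < seg_start \<Delta> (Suc n)"
  shows "box_of \<Delta> j = n"
  unfolding box_of_def using assms box_unique by blast

lemma ex_box:
  assumes "0 \<le> j"
  obtains n where "seg_start \<Delta> n \<le> j" "j < seg_start \<Delta> (Suc n)"
proof -
  have "int n \<le> seg_start \<Delta> n" for n
  proof (induction n)
    case (Suc n)
    then show ?case using cap_pos[of "int n"] by simp
  qed simp
  from this[of "Suc (nat j)"] have "j < seg_start \<Delta> (Suc (nat j))"
    using assms by linarith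
  then obtain n where "\<not> j < seg_start \<Delta> n" "j < seg_start \<Delta> (Suc n)"
    using ex_least_nat_less[of "\<lambda>n. j < seg_start \<Delta> n" "Suc (nat j)"] assms by auto
  then show ?thesis using that[of n] by simp
qed

lemma bbs_state_of_nat:
  assumes "\<And>n. 0 \<le> v (int n) \<and> v (int n) \<le> \<Delta> (int n)" "\<And>n. n < 0 \<Longrightarrow> v n = 0"
    and "\<And>n. L \<le> n \<Longrightarrow> v (int n) = 0"
  shows "bbs_state \<Delta> v"
proof -
  have "0 \<le> v n \<and> v n \<le> \<Delta> n" for n
    using assms(1)[of "nat n"] assms(2)[of n] cap_pos[of n] by (cases "n < 0") auto
  moreover have "{n. v n \<noteq> 0} \<subseteq> {0..<int L}"
  proof
    fix n assume "n \<in> {n. v n \<noteq> 0}"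
    then show "n \<in> {0..<int L}"
      using assms(2)[of n] assms(3)[of "nat n"] by (cases "n < 0"; cases "L \<le> nat n") auto
  qed
  then have "finite {n. v n \<noteq> 0}" by (rule finite_subset) simp
  ultimately show ?thesis using assms(2) by (simp add: bbs_state_def)
qed

end

section \<open>States in terms of up boxes and down boxes\<close>

locale box_state = boxes \<Delta> for \<Delta> +
  fixes u :: "int \<Rightarrow> int"
  assumes state: "bbs_state \<Delta> u"
begin

lemma u_nonneg: "0 \<le> u n" and u_le: "u n \<le> \<Delta> n"
  using state by (auto simp: bbs_state_def)

lemma u_neg: "n < 0 \<Longrightarrow> u n = 0"
  using state by (simp add: bbs_state_def)

lemma eventually_no_balls:
  obtains L where "\<And>n. L \<le> n \<Longrightarrow> u (int n) = 0"
proof -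
  have "finite {n. u n \<noteq> 0}" using state by (simp add: bbs_state_def)
  then obtain B where B: "\<And>n. u n \<noteq> 0 \<Longrightarrow> n \<le> B"
    using bdd_above_finite[of "{n. u n \<noteq> 0}"] unfolding bdd_above_def by blast
  have "u (int n) = 0" if "nat B + 1 \<le> n" for n
  proof (rule ccontr)
    assume "u (int n) \<noteq> 0"
    then show False using B[of "int n"] that by linarith
  qed
  then show thesis by (rule that)
qed

end

text \<open>\<open>p i\<close> and \<open>q i\<close> are the boxes containing the leftmost segments of the \<open>i\<close>th soliton and of
  the empty block that follows it.\<close>

locale soliton_boxes = box_state \<Delta> u for \<Delta> u +
  fixes N :: nat and p q :: "nat \<Rightarrow> nat"
  assumes up_less_down: "i < N \<Longrightarrow> p i < q i"
    and up_pos: "i < N \<Longrightarrow> 0 < u (int (p i))"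
    and down_less: "i < N \<Longrightarrow> u (int (q i)) < \<Delta> (int (q i))"
    and full: "i < N \<Longrightarrow> p i < n \<Longrightarrow> n < q i \<Longrightarrow> u (int n) = \<Delta> (int n)"
    and down_less_up: "Suc i < N \<Longrightarrow> q i < p (Suc i)"
    and outside: "u (int n) \<noteq> 0 \<Longrightarrow> \<exists>i<N. p i \<le> n \<and> n \<le> q i"
begin

text \<open>The segment before an up box is 0, so its balls sit at its right end; the segment before
  a down box is 1, so its balls sit at its left end. \<open>sol_end i\<close> is the first segment
  behind the soliton.\<close>

definition "sol_start i = seg_start \<Delta> (Suc (p i)) - u (int (p i))"
definition "sol_end i = seg_start \<Delta> (q i) + u (int (q i))"

lemma separated: "i < j \<Longrightarrow> j < N \<Longrightarrow> q i < p j"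
proof (induction j)
  case (Suc j)
  show ?case
  proof (cases "i = j")
    case True
    then show ?thesis using down_less_up Suc.prems by simp
  next
    case False
    then have "q i < p j" using Suc by simp
    also have "p j < q j" using up_less_down Suc.prems by simp
    also have "q j < p (Suc j)" using down_less_up Suc.prems by simp
    finally show ?thesis .
  qed
qed simp

lemma index_unique:
  assumes "i < N" "j < N" "p i \<le> n" "n \<le> q i" "p j \<le> n" "n \<le> q j"
  shows "i = j"
  using separated[of i j] separated[of j i] assms by (meson leD le_trans linorder_neqE_nat order_le_less_trans)

lemma sol_start_ge: "seg_start \<Delta> (p i) \<le> sol_start i"
  using u_le[of "int (p i)"] by (simp add: sol_start_def)

lemma sol_start_less: "i < N \<Longrightarrow> sol_start i < seg_start \<Delta> (Suc (p i))"
  using up_pos[of i] by (simp add: sol_start_def)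

lemma sol_end_ge: "seg_start \<Delta> (q i) \<le> sol_end i"
  using u_nonneg[of "int (q i)"] by (simp add: sol_end_def)

lemma sol_end_less: "i < N \<Longrightarrow> sol_end i < seg_start \<Delta> (Suc (q i))"
  using down_less[of i] by (simp add: sol_end_def)

lemma sol_start_less_end: "i < N \<Longrightarrow> sol_start i < sol_end i"
  using sol_start_less[of i] sol_end_ge[of i] seg_start_mono[of "Suc (p i)" "q i"] up_less_down[of i]
  by simp

lemma sol_end_less_start: "i < j \<Longrightarrow> j < N \<Longrightarrow> sol_end i < sol_start j"
  using sol_start_ge[of j] sol_end_less[of i] seg_start_mono[of "Suc (q i)" "p j"] separated[of i j]
  by simp

definition "in_soliton j \<longleftrightarrow> (\<exists>i<N. sol_start i \<le> j \<and> j < sol_end i)"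

lemma box_bounds:
  assumes "i < N" "sol_start i \<le> j" "j < sol_end i"
    and "seg_start \<Delta> n \<le> j" "j < seg_start \<Delta> (Suc n)"
  shows "p i \<le> n" "n \<le> q i"
proof -
  show "p i \<le> n"
    using seg_start_mono[of "Suc n" "p i"] sol_start_ge[of i] assms by linarith
  show "n \<le> q i"
    using seg_start_mono[of "Suc (q i)" n] sol_end_less[of i] assms by linarith
qed

text \<open>The recursion remembers only the segment before box \<open>n\<close>. That segment is 1
  exactly when \<open>p i < n \<le> q i\<close> for some \<open>i\<close>, and then the balls are
  packed to the left. Otherwise box \<open>n\<close> is an up box or empty, and they are packed to
  the right.\<close>

lemma expand_upto_eq: "expand_upto \<Delta> u n j \<longleftrightarrow> j < seg_start \<Delta> n \<and> in_soliton j"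
proof (induction n arbitrary: j)
  case 0
  have "0 \<le> sol_start i" for i
    using sol_start_ge[of i] seg_start_nonneg[of "p i"] by linarith
  then have "\<not> (\<exists>i<N. sol_start i \<le> j \<and> j < sol_end i)" if "j < 0"
    using that by (metis dual_order.trans not_le)
  then show ?case by (auto simp: in_soliton_def)
next
  case (Suc n)
  show ?case
  proof (cases "seg_start \<Delta> n \<le> j \<and> j \<le> seg_start \<Delta> n + \<Delta> (int n) - 1")
    case False
    then have "expand_upto \<Delta> u (Suc n) j \<longleftrightarrow> expand_upto \<Delta> u n j"
      by (simp only: expand_upto.simps if_False)
    moreover have "j < seg_start \<Delta> n \<longleftrightarrow> j < seg_start \<Delta> (Suc n)"
      using False cap_pos[of "int n"] by auto
    ultimately show ?thesis using Suc.IH[of j] by simp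
  next
    case True
    then have j: "seg_start \<Delta> n \<le> j" "j < seg_start \<Delta> (Suc n)" by auto
    show ?thesis
    proof (cases "in_soliton (seg_start \<Delta> n - 1)")
      case carry: True
      then obtain i where i: "i < N" "sol_start i \<le> seg_start \<Delta> n - 1" "seg_start \<Delta> n - 1 < sol_end i"
        by (auto simp: in_soliton_def)
      have pn: "p i < n"
        using seg_start_mono[of n "p i"] sol_start_ge[of i] i by linarith
      have nq: "n \<le> q i"
        using seg_start_mono[of "Suc (q i)" n] sol_end_less[of i] i by linarith
      have "in_soliton j \<longleftrightarrow> j < sol_end i"
      proof
        assume "in_soliton j"
        then obtain k where k: "k < N" "sol_start k \<le> j" "j < sol_end k"
          by (auto simp: in_soliton_def)
        have "k = i" using box_bounds[OF k j] index_unique[of k i n] k i pn nq by simp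
        then show "j < sol_end i" using k by simp
      next
        assume "j < sol_end i"
        then show "in_soliton j" using i j by (force simp: in_soliton_def)
      qed
      also have "\<dots> \<longleftrightarrow> j < seg_start \<Delta> n + u (int n)"
      \<comment> \<open>Before \<open>q i\<close>, box \<open>n\<close> is full and both conditions
        hold for all its segments; at \<open>q i\<close> the bound is \<open>sol_end i\<close>
        itself.\<close>
      proof (cases "n = q i")
        case False
        then show ?thesis
          using full[of i n] i pn nq j sol_end_ge[of i] seg_start_mono[of "Suc n" "q i"] by simp
      qed (simp add: sol_end_def)
      finally have "in_soliton j \<longleftrightarrow> j < seg_start \<Delta> n + u (int n)" .
      then show ?thesis
        using Suc.IH[of "seg_start \<Delta> n - 1"] carry j by simp
    next
      case no_carry: False
      have no_carry_in: "\<not> (p k < n \<and> n \<le> q k)" if "k < N" for k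
      proof
        assume "p k < n \<and> n \<le> q k"
        then have "sol_start k \<le> seg_start \<Delta> n - 1" "seg_start \<Delta> n - 1 < sol_end k"
          using sol_start_less[OF that] seg_start_mono[of "Suc (p k)" n] sol_end_ge[of k]
            seg_start_mono[of n "q k"] by linarith+
        then show False using no_carry that by (auto simp: in_soliton_def)
      qed
      have "in_soliton j \<longleftrightarrow> seg_start \<Delta> (Suc n) - u (int n) \<le> j"
      proof
        assume "in_soliton j"
        then obtain k where k: "k < N" "sol_start k \<le> j" "j < sol_end k"
          by (auto simp: in_soliton_def)
        have "\<not> p k < n"
          using no_carry_in[of k] k box_bounds[OF k j] by auto
        then have "p k = n" using box_bounds[OF k j] by simp
        then show "seg_start \<Delta> (Suc n) - u (int n) \<le> j" using k by (simp add: sol_start_def)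
      next
        assume *: "seg_start \<Delta> (Suc n) - u (int n) \<le> j"
        then have "u (int n) \<noteq> 0" using j by auto
        then obtain k where k: "k < N" "p k \<le> n" "n \<le> q k" using outside by blast
        have "\<not> p k < n"
          using no_carry_in[of k] k by auto
        then have [simp]: "n = p k" using k by simp
        have "sol_start k \<le> j" using * by (simp add: sol_start_def)
        moreover have "j < sol_end k"
          using j sol_end_ge[of k] seg_start_mono[of "Suc (p k)" "q k"] up_less_down[of k] k by simp
        ultimately show "in_soliton j" using k by (auto simp: in_soliton_def)
      qed
      then show ?thesis
        using Suc.IH[of "seg_start \<Delta> n - 1"] no_carry j by simp
    qed
  qed
qed

lemma expansion_iff: "expansion \<Delta> u j \<longleftrightarrow> in_soliton j"
proof (cases "0 \<le> j")
  case True
  then obtain n where n: "seg_start \<Delta> n \<le> j" "j < seg_start \<Delta> (Suc n)" using ex_box by blast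
  show ?thesis
    unfolding expansion_def box_of_eq[OF n] expand_upto_eq using True n(2) by blast
next
  case False
  \<comment> \<open>At \<open>n = 0\<close> nothing is filled yet, so the equivalence says that
    solitons contain no negative segment.\<close>
  then show ?thesis
    using expand_upto_eq[of 0 j] by (simp add: expansion_def)
qed

lemma sol_start_strict_mono: "strict_mono_on {..<N} sol_start"
proof (rule strict_mono_onI)
  fix i j assume "i \<in> {..<N}" "j \<in> {..<N}" "i < j"
  then show "sol_start i < sol_start j"
    using sol_start_less_end[of i] sol_end_less_start[of i j] by simp
qed

lemma soliton_starts_eq: "soliton_starts \<Delta> u = sol_start ` {..<N}"
proof (intro equalityI subsetI)
  fix j assume "j \<in> soliton_starts \<Delta> u"
  then obtain i where i: "i < N" "sol_start i \<le> j" "j < sol_end i" and "\<not> in_soliton (j - 1)"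
    by (auto simp: soliton_starts_def expansion_iff in_soliton_def)
  then have "j = sol_start i" by (force simp: in_soliton_def)
  then show "j \<in> sol_start ` {..<N}" using i by simp
next
  fix j assume "j \<in> sol_start ` {..<N}"
  then obtain i where i: "i < N" "j = sol_start i" by auto
  have "\<not> in_soliton (j - 1)"
  proof
    assume "in_soliton (j - 1)"
    then obtain k where k: "k < N" "sol_start k \<le> j - 1" "j - 1 < sol_end k"
      by (auto simp: in_soliton_def)
    then have "k < i"
      using i sol_end_less_start[of i k] sol_start_less_end[of i] by (cases i k rule: linorder_cases) auto
    then show False using sol_end_less_start[of k i] i k by simp
  qed
  then show "j \<in> soliton_starts \<Delta> u"
    using i sol_start_less_end[of i] by (auto simp: soliton_starts_def expansion_iff in_soliton_def)
qed

lemma inj_sol_start: "inj_on sol_start {..<N}"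
  by (simp add: sol_start_strict_mono strict_mono_on_imp_inj_on)

lemma num_solitons_eq: "num_solitons \<Delta> u = N"
  by (simp add: num_solitons_def soliton_starts_eq card_image inj_sol_start)

text \<open>Matches the numbering in the definition of \<open>soliton\<close> with the index
  \<open>i\<close> of the boxes.\<close>

lemma sorted_soliton_starts:
  "sorted_list_of_set (soliton_starts \<Delta> u) = map sol_start [0..<N]"
proof (rule sorted_distinct_set_unique)
  show "sorted (map sol_start [0..<N])"
    using sol_start_strict_mono
    by (auto simp: sorted_iff_nth_mono intro!: strict_mono_on_leD[of "{..<N}"])
  show "distinct (map sol_start [0..<N])"
    using inj_sol_start by (simp add: distinct_map atLeast0LessThan)
qed (auto simp: soliton_starts_eq)

lemma soliton_eq:
  assumes "i < N"
  shows "soliton \<Delta> u i = {sol_start i..<sol_end i}"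
proof -
  have nth: "sorted_list_of_set (soliton_starts \<Delta> u) ! i = sol_start i"
    using assms by (simp add: sorted_soliton_starts)
  have notin: "\<not> in_soliton (sol_end i)"
  proof
    assume "in_soliton (sol_end i)"
    then obtain k where k: "k < N" "sol_start k \<le> sol_end i" "sol_end i < sol_end k"
      by (auto simp: in_soliton_def)
    then show False
      using sol_end_less_start[of i k] sol_end_less_start[of k i] sol_start_less_end[of i] assms
      by (cases i k rule: linorder_cases) auto
  qed
  show ?thesis
    unfolding soliton_def nth Let_def expansion_iff
  proof (intro equalityI subsetI)
    fix j assume "j \<in> {j. sol_start i \<le> j \<and> (\<forall>i\<in>{sol_start i..j}. in_soliton i)}"
    then show "j \<in> {sol_start i..<sol_end i}"
      using notin sol_start_less_end[OF assms] by force
  qed (use assms in \<open>auto simp: in_soliton_def\<close>)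
qed

text \<open>In the up box and the down box the soliton has one segment per ball; the boxes between
  are full, so there segments and balls are equally many.\<close>

lemma soliton_size_eq:
  assumes "i < N"
  shows "soliton_size \<Delta> u i = seg_start u (Suc (q i)) - seg_start u (p i)"
  using sol_start_less_end[OF assms] seg_start_diff_cong[of "Suc (p i)" "q i" u \<Delta>] full[OF assms]
    up_less_down[OF assms]
  by (simp add: soliton_size_def soliton_eq assms sol_start_def sol_end_def)

lemma leftmost_box_soliton:
  assumes "i < N"
  shows "leftmost_box \<Delta> (soliton \<Delta> u i) = int (p i)"
  using box_of_eq[OF sol_start_ge sol_start_less[OF assms]] sol_start_less_end[OF assms]
  by (simp add: leftmost_box_def soliton_eq[OF assms] Least_int_atLeastLessThan del: atLeastLessThan_iff)

lemma soliton_cap_eq: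
  "soliton_cap \<Delta> \<kappa> u i = (if i < N then \<Delta> (int (p i)) else \<kappa>)"
  by (simp add: soliton_cap_def num_solitons_eq leftmost_box_soliton)

lemma all_soliton_less_iff:
  assumes "i < N"
  shows "(\<forall>k\<in>soliton \<Delta> u i. k < j) \<longleftrightarrow> sol_end i \<le> j"
  using sol_start_less_end[OF assms] by (auto simp: soliton_eq[OF assms] dest: bspec[of _ _ "sol_end i - 1"])

lemma less_all_soliton_iff:
  assumes "i < N"
  shows "(\<forall>k\<in>soliton \<Delta> u i. j < k) \<longleftrightarrow> j < sol_start i"
  using sol_start_less_end[OF assms] by (auto simp: soliton_eq[OF assms] dest: bspec[of _ _ "sol_start i"])

lemma empty_block_eq:
  assumes "0 < i" "i < N"
  shows "empty_block \<Delta> u i = {sol_end (i - 1)..<sol_start i}"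
  using assms
  by (auto simp: empty_block_def all_soliton_less_iff less_all_soliton_iff num_solitons_eq)

lemma empty_block_0: "0 < N \<Longrightarrow> empty_block \<Delta> u 0 = {..<sol_start 0}"
  by (auto simp: empty_block_def less_all_soliton_iff num_solitons_eq)

lemma empty_block_N: "0 < N \<Longrightarrow> empty_block \<Delta> u N = {sol_end (N - 1)..}"
  by (auto simp: empty_block_def all_soliton_less_iff num_solitons_eq)

lemma empty_size_0: "0 < N \<Longrightarrow> empty_size \<Delta> u 0 = \<infinity>"
  by (simp add: empty_size_def empty_block_0 infinite_Iio)

lemma empty_size_N: "0 < N \<Longrightarrow> empty_size \<Delta> u N = \<infinity>"
  by (simp add: empty_size_def empty_block_N infinite_Ici)

lemma leftmost_box_empty:
  assumes "i < N"
  shows "leftmost_box \<Delta> (empty_block \<Delta> u (Suc i)) = int (q i)"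
proof -
  have "(LEAST j. j \<in> empty_block \<Delta> u (Suc i)) = sol_end i"
  proof (cases "Suc i = N")
    case True
    then have "empty_block \<Delta> u (Suc i) = {sol_end i..}" using empty_block_N by auto
    then show ?thesis by (auto intro: Least_equality)
  next
    case False
    then have i: "Suc i < N" using assms by simp
    then have "empty_block \<Delta> u (Suc i) = {sol_end i..<sol_start (Suc i)}"
      using empty_block_eq[of "Suc i"] by simp
    then show ?thesis
      using Least_int_atLeastLessThan sol_end_less_start[OF _ i] by simp
  qed
  then show ?thesis
    using box_of_eq[OF sol_end_ge sol_end_less[OF assms]] by (simp add: leftmost_box_def)
qed

text \<open>The conditional bound on \<open>n\<close> lets the last soliton be included, behind
  which all boxes are empty.\<close>

lemma between_solitons:
  assumes "i < N" "q i < n" "Suc i < N \<Longrightarrow> n < p (Suc i)"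
  shows "u (int n) = 0"
proof (rule ccontr)
  assume "u (int n) \<noteq> 0"
  then obtain k where k: "k < N" "p k \<le> n" "n \<le> q k" using outside by blast
  show False
  proof (cases k i rule: linorder_cases)
    case less
    then show False using k assms separated[of k i] up_less_down[of i] by simp
  next
    case greater
    then show False
      using k assms separated[of "Suc i" k] up_less_down[of "Suc i"] by (cases "k = Suc i") auto
  qed (use k assms in simp)
qed

lemma before_solitons:
  assumes "0 < N" "n < p 0"
  shows "u (int n) = 0"
proof (rule ccontr)
  assume "u (int n) \<noteq> 0"
  then obtain k where k: "k < N" "p k \<le> n" using outside by blast
  then show False
    using assms separated[of 0 k] up_less_down[of 0] by (cases "k = 0") auto
qed

lemma seg_start_gap:
  assumes "Suc i < N"
  shows "seg_start u (p (Suc i)) = seg_start u (Suc (q i))"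
  using assms down_less_up[OF assms] between_solitons[of i] by (intro seg_start_const) auto

text \<open>The block consists of the vacancies of the boxes \<open>q i, ..., p (Suc i)\<close>:
  those of the down box lie at its right end, those of the up box at its left end.\<close>

lemma empty_size_eq:
  assumes "Suc i < N"
  shows "empty_size \<Delta> u (Suc i) =
    ereal (real_of_int ((seg_start \<Delta> (Suc (p (Suc i))) - seg_start u (Suc (p (Suc i))))
      - (seg_start \<Delta> (q i) - seg_start u (q i))))"
proof -
  have "sol_end i < sol_start (Suc i)" using sol_end_less_start[of i "Suc i"] assms by simp
  then have "empty_size \<Delta> u (Suc i) = ereal (real_of_int (sol_start (Suc i) - sol_end i))"
    using empty_block_eq[of "Suc i"] assms by (simp add: empty_size_def)
  also have "sol_start (Suc i) - sol_end i = (seg_start \<Delta> (Suc (p (Suc i))) - seg_start u (Suc (p (Suc i))))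
      - (seg_start \<Delta> (q i) - seg_start u (q i))"
    using seg_start_gap[OF assms] by (simp add: sol_start_def sol_end_def)
  finally show ?thesis .
qed

end

section \<open>Existence of the up and down boxes\<close>

text \<open>Greedy scan: the first nonempty box is an up box, the first box behind it that is not
  full is its down box, and the scan resumes at the next box. The start \<open>m\<close> is
  arbitrary to allow this recursion.\<close>

lemma (in boxes) ex_soliton_boxes_from:
  assumes state: "bbs_state \<Delta> u" and bound: "\<forall>n\<ge>L. u (int n) = 0"
  shows "\<exists>N p q. (\<forall>i<N. m \<le> p i \<and> p i < q i \<and> 0 < u (int (p i)) \<and> u (int (q i)) < \<Delta> (int (q i)) \<and>
       (\<forall>n. p i < n \<longrightarrow> n < q i \<longrightarrow> u (int n) = \<Delta> (int n))) \<and>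
     (\<forall>i. Suc i < N \<longrightarrow> q i < p (Suc i)) \<and>
     (\<forall>n\<ge>m. u (int n) \<noteq> 0 \<longrightarrow> (\<exists>i<N. p i \<le> n \<and> n \<le> q i))"
proof (induction "L - m" arbitrary: m rule: less_induct)
  case less
  show ?case
  proof (cases "\<exists>n\<ge>m. u (int n) \<noteq> 0")
    case False
    then show ?thesis by (intro exI[of _ 0]) auto
  next
    case True
    define a where "a = (LEAST n. m \<le> n \<and> u (int n) \<noteq> 0)"
    have a: "m \<le> a" "u (int a) \<noteq> 0"
      using LeastI_ex[OF True[unfolded Bex_def]] by (auto simp: a_def)
    have below_a: "u (int n) = 0" if "m \<le> n" "n < a" for n
      using not_less_Least[of n "\<lambda>n. m \<le> n \<and> u (int n) \<noteq> 0"] that by (auto simp: a_def)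
    have "a < L" using a bound by (meson not_le)
    define b where "b = (LEAST n. a < n \<and> u (int n) < \<Delta> (int n))"
    have "a < L \<and> u (int L) < \<Delta> (int L)" using \<open>a < L\<close> bound cap_pos by simp
    then have b: "a < b" "u (int b) < \<Delta> (int b)"
      using LeastI[of "\<lambda>n. a < n \<and> u (int n) < \<Delta> (int n)"] by (auto simp: b_def)
    have below_b: "u (int n) = \<Delta> (int n)" if "a < n" "n < b" for n
    proof -
      have "\<not> u (int n) < \<Delta> (int n)"
        using not_less_Least[of n "\<lambda>n. a < n \<and> u (int n) < \<Delta> (int n)"] that by (auto simp: b_def)
      moreover have "u (int n) \<le> \<Delta> (int n)" using state by (simp add: bbs_state_def)
      ultimately show ?thesis by simp
    qed
    have "L - Suc b < L - m" using a b \<open>a < L\<close> by simp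
    from less[OF this] obtain N p q where IH: "\<forall>i<N. Suc b \<le> p i \<and> p i < q i \<and> 0 < u (int (p i)) \<and> u (int (q i)) < \<Delta> (int (q i)) \<and>
       (\<forall>n. p i < n \<longrightarrow> n < q i \<longrightarrow> u (int n) = \<Delta> (int n))"
      "\<forall>i. Suc i < N \<longrightarrow> q i < p (Suc i)"
      "\<forall>n\<ge>Suc b. u (int n) \<noteq> 0 \<longrightarrow> (\<exists>i<N. p i \<le> n \<and> n \<le> q i)"
      by (elim exE conjE)
    have "0 \<le> u (int a)" using state by (simp add: bbs_state_def)
    then have "0 < u (int a)" using a(2) by linarith
    \<comment> \<open>The pair \<open>a\<close>, \<open>b\<close> is put in front of the boxes found
      by the scan from \<open>Suc b\<close>.\<close>
    let ?p = "case_nat a p" and ?q = "case_nat b q"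
    have "m \<le> ?p i \<and> ?p i < ?q i \<and> 0 < u (int (?p i)) \<and> u (int (?q i)) < \<Delta> (int (?q i)) \<and>
       (\<forall>n. ?p i < n \<longrightarrow> n < ?q i \<longrightarrow> u (int n) = \<Delta> (int n))" if "i < Suc N" for i
    proof (cases i)
      case 0
      then show ?thesis using a b below_b \<open>0 < u (int a)\<close> by simp
    next
      case (Suc k)
      then have "k < N" using that by simp
      from IH(1)[rule_format, OF this] show ?thesis using a b Suc by simp
    qed
    moreover have "?q i < ?p (Suc i)" if "Suc i < Suc N" for i
    proof (cases i)
      case 0
      then have "0 < N" using that by simp
      from IH(1)[rule_format, OF this] show ?thesis using 0 by simp
    next
      case (Suc k)
      then show ?thesis using IH(2) that by simp
    qed
    moreover have "\<exists>i<Suc N. ?p i \<le> n \<and> n \<le> ?q i" if n: "m \<le> n" "u (int n) \<noteq> 0" for n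
    proof -
      have "a \<le> n" using below_a n by (meson not_le)
      show ?thesis
      proof (cases "n \<le> b")
        case True
        then show ?thesis using \<open>a \<le> n\<close> by (intro exI[of _ 0]) simp
      next
        case False
        then obtain i where "i < N" "p i \<le> n" "n \<le> q i" using IH(3) n by (metis Suc_leI not_le)
        then show ?thesis by (intro exI[of _ "Suc i"]) simp
      qed
    qed
    ultimately show ?thesis by blast
  qed
qed

lemma (in boxes) ex_soliton_boxes:
  assumes state: "bbs_state \<Delta> u"
  obtains N p q where "soliton_boxes \<Delta> u N p q"
proof -
  from state interpret box_state by unfold_locales
  obtain L where "\<And>n. L \<le> n \<Longrightarrow> u (int n) = 0" using eventually_no_balls by blast
  then have bound: "\<forall>n\<ge>L. u (int n) = 0" by blast
  from ex_soliton_boxes_from[where m = 0, OF state bound] obtain N p q where *: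
    "\<forall>i<N. 0 \<le> p i \<and> p i < q i \<and> 0 < u (int (p i)) \<and> u (int (q i)) < \<Delta> (int (q i)) \<and>
       (\<forall>n. p i < n \<longrightarrow> n < q i \<longrightarrow> u (int n) = \<Delta> (int n))"
    "\<forall>i. Suc i < N \<longrightarrow> q i < p (Suc i)"
    "\<forall>n\<ge>0. u (int n) \<noteq> 0 \<longrightarrow> (\<exists>i<N. p i \<le> n \<and> n \<le> q i)" by (elim exE conjE)
  have "soliton_boxes \<Delta> u N p q"
  proof
    fix i assume "i < N"
    from *(1)[rule_format, OF this]
    show "p i < q i" "0 < u (int (p i))" "u (int (q i)) < \<Delta> (int (q i))"
      and "\<And>n. p i < n \<Longrightarrow> n < q i \<Longrightarrow> u (int n) = \<Delta> (int n)" by blast+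
  qed (use *(2,3) in blast)+
  then show thesis by (rule that)
qed

section \<open>The carrier along the boxes\<close>

lemma restrict_to_cases:
  obtains (bounded) m where "0 \<le> m" "\<And>x. restrict_to M x = min x m"
    | (unbounded) "\<And>x. restrict_to M x = x"
proof (cases M)
  case (enat m)
  then show thesis using bounded[of "int m"] by (simp add: restrict_to_def)
next
  case infinity
  then show thesis using unbounded by (simp add: restrict_to_def)
qed

lemma restrict_to_eq_min: "ereal (real_of_int (restrict_to M x)) = min (ereal x) (ereal_of_enat M)"
  by (cases M) (auto simp: restrict_to_def min_def)

text \<open>Bounds by the carrier capacity are used below as fixed points of
  \<open>restrict_to M\<close>, which treats finite and infinite capacities alike.\<close>

lemma restrict_to_fixed_iff: "ereal (real_of_int x) \<le> ereal_of_enat M \<longleftrightarrow> restrict_to M x = x"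
  by (cases M) (auto simp: restrict_to_def min_def)

lemma restrict_to_mono: "x \<le> y \<Longrightarrow> restrict_to M x \<le> restrict_to M y"
  by (cases M rule: restrict_to_cases) auto

text \<open>What the inner cut discards would be discarded by the outer one too, as balls are only
  added in between. Successive cuts thereby merge into one.\<close>

lemma restrict_to_add:
  "0 \<le> d \<Longrightarrow> restrict_to M (restrict_to M x + d) = restrict_to M (x + d)"
  by (cases M rule: restrict_to_cases) auto

locale carrier = box_state \<Delta> u for \<Delta> u +
  fixes M :: enat
begin

abbreviation "R \<equiv> restrict_to M"
abbreviation "ubar \<equiv> size_limit \<Delta> M u"
abbreviation "unew \<equiv> recovery \<Delta> M u"

definition "load n = carrier_load \<Delta> M u (int n)"
definition "held n = R (load n + u (int n))"

lemma load_0 [simp]: "load 0 = 0"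
  by (simp add: load_def carrier_load.simps)

lemma ubar_eq: "ubar (int n) = min (\<Delta> (int n) - u (int n)) (load n)"
  by (simp add: size_limit_def load_def)

lemma load_Suc: "load (Suc n) = held n - ubar (int n)"
  unfolding load_def held_def
  by (subst carrier_load.simps) (simp add: size_limit_def)

lemma unew_eq: "unew (int n) = u (int n) + load n - load (Suc n)"
  by (simp add: recovery_def load_def add.commute)

text \<open>The two bounds need each other: as the load is within the capacity,
  \<open>held n \<ge> load n \<ge> ubar (int n)\<close>, so the next load is nonnegative.\<close>

lemma load_bounds: "0 \<le> load n \<and> R (load n) = load n"
proof (induction n)
  case 0
  then show ?case by (cases M rule: restrict_to_cases) auto
next
  case (Suc n)
  then show ?case
    using u_nonneg[of "int n"] u_le[of "int n"]
    by (cases M rule: restrict_to_cases) (auto simp: load_Suc held_def ubar_eq)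
qed

lemma load_nonneg: "0 \<le> load n" and R_load: "R (load n) = load n"
  using load_bounds by auto

lemma ubar_nonneg: "0 \<le> ubar (int n)"
  using load_nonneg[of n] u_le[of "int n"] by (simp add: ubar_eq)

lemma ubar_le: "ubar (int n) \<le> \<Delta> (int n) - u (int n)"
  by (simp add: ubar_eq)

text \<open>The recovered content is \<open>ubar (int n)\<close> plus the number of removed balls,
  \<open>load n + u (int n) - held n\<close>.\<close>

lemma unew_ge: "ubar (int n) \<le> unew (int n)"
  by (cases M rule: restrict_to_cases) (auto simp: unew_eq load_Suc held_def)

text \<open>Since \<open>held n \<ge> load n\<close>, at most \<open>u (int n)\<close> balls are
  removed in this box, and \<open>ubar (int n)\<close> leaves room for as many.\<close>

lemma unew_le: "unew (int n) \<le> \<Delta> (int n)"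
  using load_bounds[of n] u_nonneg[of "int n"] u_le[of "int n"]
  by (cases M rule: restrict_to_cases) (auto simp: unew_eq load_Suc held_def ubar_eq)

lemma load_Suc_empty: "u (int n) = 0 \<Longrightarrow> load (Suc n) = load n - ubar (int n)"
  by (simp add: load_Suc held_def R_load)

lemma load_zero_stays:
  assumes "n \<le> k" "load n = 0" "\<And>i. n \<le> i \<Longrightarrow> i < k \<Longrightarrow> u (int i) = 0"
  shows "load k = 0"
  using assms
proof (induction k rule: dec_induct)
  case (step k)
  then show ?case
    using cap_pos[of "int k"] by (simp add: load_Suc_empty ubar_eq)
qed

lemma eventually_empty:
  obtains L where "\<And>n. L \<le> n \<Longrightarrow> u (int n) = 0" "\<And>n. L \<le> n \<Longrightarrow> load n = 0"
proof -
  obtain L where u0: "\<And>n. L \<le> n \<Longrightarrow> u (int n) = 0" using eventually_no_balls by blast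
  \<comment> \<open>Behind the last ball the carrier drops at least one ball per box until it is
    empty.\<close>
  have decr: "load (L + k) \<le> max 0 (load L - int k)" for k
  proof (induction k)
    case 0
    then show ?case by simp
  next
    case (Suc k)
    then show ?case
      using u0[of "L + k"] cap_pos[of "int (L + k)"] load_Suc_empty[of "L + k"] ubar_eq[of "L + k"]
      by (auto simp: min_def max_def split: if_splits)
  qed
  let ?L = "L + nat (load L)"
  have "load ?L = 0" using decr[of "nat (load L)"] load_nonneg[of ?L] load_nonneg[of L] by simp
  have "u (int n) = 0" if "?L \<le> n" for n by (rule u0) (use that in simp)
  moreover from this have "load n = 0" if "?L \<le> n" for n
    using load_zero_stays[OF that \<open>load ?L = 0\<close>] by simp
  ultimately show thesis by (rule that)
qed

lemma carrier_load_neg: "n \<le> 0 \<Longrightarrow> carrier_load \<Delta> M u n = 0"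
  by (simp add: carrier_load.simps)

lemma bbs_state_ubar: "bbs_state \<Delta> ubar"
proof -
  obtain L where "\<And>n. L \<le> n \<Longrightarrow> u (int n) = 0" "\<And>n. L \<le> n \<Longrightarrow> load n = 0"
    using eventually_empty by blast
  then show ?thesis
  proof (intro bbs_state_of_nat[of _ L])
    fix n :: int assume "n < 0"
    then show "ubar n = 0" using u_le[of n] by (simp add: size_limit_def carrier_load_neg)
  next
    fix n show "0 \<le> ubar (int n) \<and> ubar (int n) \<le> \<Delta> (int n)"
      using ubar_nonneg[of n] ubar_le[of n] u_nonneg[of "int n"] by simp
  qed (use cap_pos in \<open>simp add: ubar_eq less_imp_le\<close>)
qed

lemma bbs_state_unew: "bbs_state \<Delta> unew"
proof -
  obtain L where "\<And>n. L \<le> n \<Longrightarrow> u (int n) = 0" "\<And>n. L \<le> n \<Longrightarrow> load n = 0"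
    using eventually_empty by blast
  then show ?thesis
  proof (intro bbs_state_of_nat[of _ L])
    fix n :: int assume "n < 0"
    then show "unew n = 0"
      by (simp add: recovery_def carrier_load_neg u_neg)
  next
    fix n show "0 \<le> unew (int n) \<and> unew (int n) \<le> \<Delta> (int n)"
      using ubar_nonneg[of n] unew_ge[of n] unew_le[of n] by simp
  qed (simp add: unew_eq)
qed

text \<open>In each box the contents differ by a difference of consecutive loads, so the sum
  telescopes down to \<open>load 0 = 0\<close>.\<close>

lemma seg_start_unew: "seg_start unew n = seg_start u n - load n"
  by (induction n) (simp_all add: unew_eq)

text \<open>Without removal the carrier puts down at most \<open>load n\<close> of its
  \<open>load n + u (int n)\<close> balls; after a cut it holds at least
  \<open>\<Delta> (int n)\<close> and puts down at most
  \<open>\<Delta> (int n) - u (int n)\<close>.\<close>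

lemma load_after_up:
  assumes "R (\<Delta> (int n)) = \<Delta> (int n)"
  shows "u (int n) \<le> load (Suc n)"
  using assms load_nonneg[of n] u_le[of "int n"]
  by (cases M rule: restrict_to_cases) (auto simp: load_Suc held_def ubar_eq)

text \<open>The whole load fits into the vacancies, so
  \<open>load n + u (int n) \<le> \<Delta> (int n)\<close> and nothing is removed. In an up box this
  is the case where \<open>carrier_C\<close> is set to \<open>soliton_cap\<close>.\<close>

lemma load_after_up_all_released:
  assumes "R (\<Delta> (int n)) = \<Delta> (int n)" "load n = ubar (int n)"
  shows "load (Suc n) = u (int n)"
  using assms load_nonneg[of n] u_le[of "int n"]
  by (cases M rule: restrict_to_cases) (auto simp: load_Suc held_def ubar_eq)

lemma load_after_up_some_left:
  assumes "ubar (int n) < load n"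
  shows "load (Suc n) = held n - \<Delta> (int n) + u (int n)"
    and "held n = R (load n - ubar (int n) + \<Delta> (int n))"
  using assms by (auto simp: load_Suc held_def ubar_eq min_def algebra_simps split: if_splits)

text \<open>If the load fits into the vacancies, nothing is removed and both sides are what stays
  free. Otherwise the box is filled, and by the capacity bound the carrier has held at least
  \<open>\<Delta> (int n)\<close> balls.\<close>

lemma vacancy_after_size_limit:
  assumes "R (\<Delta> (int n)) = \<Delta> (int n)"
  shows "\<Delta> (int n) - u (int n) - ubar (int n) = max 0 (\<Delta> (int n) - held n)"
  using assms load_nonneg[of n] u_le[of "int n"]
  by (cases M rule: restrict_to_cases) (auto simp: held_def ubar_eq)

end

section \<open>One stretch from an up box to the next\<close>

text \<open>For both states after the step, the boxes \<open>p i + 1, \<dots>, p (i + 1)\<close> contain exactly one soliton,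
  which starts no later than \<open>q i\<close>.\<close>

definition one_soliton ::
    "(int \<Rightarrow> int) \<Rightarrow> (int \<Rightarrow> int) \<Rightarrow> nat \<Rightarrow> nat \<Rightarrow> nat \<Rightarrow> nat \<Rightarrow> bool" where
  "one_soliton \<Delta> v x y a b \<longleftrightarrow> x < a \<and> a < b \<and> b \<le> y \<and>
     0 < v (int a) \<and> v (int b) < \<Delta> (int b) \<and>
     (\<forall>n. x < n \<longrightarrow> n < a \<longrightarrow> v (int n) = 0) \<and>
     (\<forall>n. a < n \<longrightarrow> n < b \<longrightarrow> v (int n) = \<Delta> (int n)) \<and>
     (\<forall>n. b < n \<longrightarrow> n \<le> y \<longrightarrow> v (int n) = 0)"

text \<open>\<open>x\<close>, \<open>q\<close> and \<open>y\<close> are an up box, its down box and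
  the next up box. The second alternative of \<open>last\<close> admits the final stretch.\<close>

locale carrier_window = carrier \<Delta> u M for \<Delta> u M +
  fixes x q y :: nat
  assumes x_less_q: "x < q" and q_less_y: "q < y"
    and x_pos: "0 < u (int x)" and cap_x: "R (\<Delta> (int x)) = \<Delta> (int x)"
    and full: "x < n \<Longrightarrow> n < q \<Longrightarrow> u (int n) = \<Delta> (int n)"
    and q_less: "u (int q) < \<Delta> (int q)"
    and empty: "q < n \<Longrightarrow> n < y \<Longrightarrow> u (int n) = 0"
    and last: "0 < u (int y) \<and> R (\<Delta> (int y)) = \<Delta> (int y) \<or> u (int y) = 0 \<and> load y = 0"
begin

lemma ubar_full: "x < n \<Longrightarrow> n < q \<Longrightarrow> ubar (int n) = 0"
  using load_nonneg[of n] by (simp add: ubar_eq full)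

lemma load_full:
  assumes "Suc x \<le> n" "n \<le> q"
  shows "load n = R (load (Suc x) + (seg_start u n - seg_start u (Suc x)))"
  using assms
proof (induction n rule: dec_induct)
  case base
  then show ?case by (simp add: R_load)
next
  case (step n)
  then have "load (Suc n) = R (load n + u (int n))"
    using ubar_full[of n] by (simp add: load_Suc held_def)
  also have "\<dots> = R (load (Suc x) + (seg_start u n - seg_start u (Suc x)) + u (int n))"
    using step restrict_to_add[OF u_nonneg] by simp
  finally show ?case by (simp add: add.assoc diff_add_eq)
qed

lemma held_q: "held q = R (load (Suc x) + (seg_start u (Suc q) - seg_start u (Suc x)))"
proof -
  have "held q = R (load (Suc x) + (seg_start u q - seg_start u (Suc x)) + u (int q))"
    using load_full[of q] x_less_q restrict_to_add[OF u_nonneg] by (simp add: held_def)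
  then show ?thesis by (simp add: add.assoc diff_add_eq)
qed

lemma load_mono_full:
  assumes "Suc x \<le> n" "n \<le> q"
  shows "load (Suc x) \<le> load n"
  using assms
proof (induction n rule: dec_induct)
  case (step n)
  have "load n = R (load n)" by (simp add: R_load)
  also have "\<dots> \<le> R (load n + u (int n))" by (rule restrict_to_mono) (simp add: u_nonneg)
  also have "\<dots> = load (Suc n)" using step ubar_full[of n] by (simp add: load_Suc held_def)
  finally show ?case using step by simp
qed simp

lemma load_pos: "x < n \<Longrightarrow> n \<le> q \<Longrightarrow> 0 < load n"
  using load_mono_full[of n] load_after_up[OF cap_x] x_pos by simp

lemma ubar_q_pos: "0 < ubar (int q)"
  using load_pos[of q] x_less_q q_less by (simp add: ubar_eq)

lemma ubar_y_less: "ubar (int y) < \<Delta> (int y)"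
  using last cap_pos[of "int y"] by (auto simp: ubar_eq)

lemma load_zero_until_y:
  assumes "q < n" "n \<le> k" "k \<le> y" "load n = 0"
  shows "load k = 0"
  using load_zero_stays[of n k] assms empty by simp

lemma load_Suc_gap: "q < n \<Longrightarrow> n < y \<Longrightarrow> load (Suc n) = load n - ubar (int n)"
  by (simp add: load_Suc_empty empty)

text \<open>The soliton starts at \<open>q\<close>, where balls are put down, and ends at the first
  later box \<open>r\<close> that is not filled. If \<open>r\<close> lies before \<open>y\<close>,
  it was empty, so the carrier has run out of balls there.\<close>

lemma ex_one_soliton_ubar: "\<exists>r. one_soliton \<Delta> ubar x y q r"
proof -
  define P where "P n \<longleftrightarrow> q < n \<and> ubar (int n) < \<Delta> (int n)" for n
  define r where "r = (LEAST n. P n)"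
  have "P y" using q_less_y ubar_y_less by (simp add: P_def)
  then have "P r" "r \<le> y" unfolding r_def by (rule LeastI, rule Least_le)
  then have r: "q < r" "ubar (int r) < \<Delta> (int r)" "r \<le> y" by (auto simp: P_def)
  have before: "ubar (int n) = \<Delta> (int n)" if "q < n" "n < r" for n
    using not_less_Least[of n P] that ubar_le[of n] u_nonneg[of "int n"] by (auto simp: P_def r_def)
  have load0: "load n = 0" if "r < n" "n \<le> y" for n
  proof -
    have "load (Suc r) = 0"
      using load_Suc_gap[of r] r that empty[of r] by (auto simp: ubar_eq)
    then show ?thesis using load_zero_until_y[of "Suc r" n] r that by simp
  qed
  have "ubar (int n) = 0" if "r < n" "n \<le> y" for n
    using load0[OF that] u_le[of "int n"] by (simp add: ubar_eq)
  then have "one_soliton \<Delta> ubar x y q r"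
    using r before x_less_q ubar_q_pos ubar_full by (simp add: one_soliton_def)
  then show ?thesis ..
qed

text \<open>The inequality expresses that the carrier is not full, also for infinite capacity. At
  \<open>q\<close> at least one ball is put down after the cut, and none is picked up between
  \<open>q\<close> and \<open>y\<close>.\<close>

lemma load_below_capacity:
  assumes "q < n" "n \<le> y"
  shows "load n < R (load n + 1)"
proof -
  have "load (Suc q) < R (load (Suc q) + 1)"
    using ubar_q_pos load_nonneg[of q] by (cases M rule: restrict_to_cases) (auto simp: load_Suc held_def)
  moreover have "load n \<le> load (Suc q)"
  proof -
    from assms have "Suc q \<le> n" by simp
    from this assms(2) show ?thesis
    proof (induction n rule: dec_induct)
      case (step n)
      then show ?case using load_Suc_gap[of n] ubar_nonneg[of n] by simp
    qed simp
  qed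
  ultimately show ?thesis by (cases M rule: restrict_to_cases) auto
qed

text \<open>The first new content appears at \<open>q\<close> or at an earlier box where balls are
  removed. In the latter case the carrier is full from there up to \<open>q\<close>, so all balls of
  the full boxes in between are removed and returned. Behind \<open>q\<close> the argument is the
  one for \<open>ubar\<close>.\<close>

lemma ex_one_soliton_unew:
  "\<exists>a b. one_soliton \<Delta> unew x y a b \<and> a \<le> q \<and> (R (\<Delta> (int q)) = \<Delta> (int q) \<longrightarrow> q < b)"
proof -
  define P where "P n \<longleftrightarrow> x < n \<and> 0 < unew (int n)" for n
  define a where "a = (LEAST n. P n)"
  have "P q" using x_less_q ubar_q_pos unew_ge[of q] by (simp add: P_def)
  then have "P a" "a \<le> q" unfolding a_def by (rule LeastI, rule Least_le)
  then have a: "x < a" "0 < unew (int a)" "a \<le> q" by (auto simp: P_def)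
  have before_a: "unew (int n) = 0" if "x < n" "n < a" for n
    using not_less_Least[of n P] that unew_ge[of n] ubar_nonneg[of n] by (auto simp: P_def a_def)
  \<comment> \<open>Box \<open>a\<close> is full and takes nothing from the carrier, so its
    recovered balls are removed ones and the carrier leaves at capacity; the equation encodes
    this.\<close>
  have sat_a: "R (load (Suc a) + 1) = load (Suc a)" if "a < q"
    using a that full[of a] ubar_full[of a]
    by (cases M rule: restrict_to_cases) (auto simp: unew_eq load_Suc held_def)
  have sat: "R (load n + 1) = load n" if "a < n" "n \<le> q" for n
  proof -
    from that have "Suc a \<le> n" by simp
    from this that(2) show ?thesis
    proof (induction n rule: dec_induct)
      case base
      then show ?case using sat_a by simp
    next
      case (step n)
      then have "R (load n + 1) = load n" by simp
      then show ?case
        using step a full[of n] ubar_full[of n] cap_pos[of "int n"]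
        by (cases M rule: restrict_to_cases) (auto simp: load_Suc held_def)
    qed
  qed
  have full_a: "unew (int n) = \<Delta> (int n)" if "a < n" "n < q" for n
    using sat[of n] sat[of "Suc n"] that full[of n] ubar_full[of n] a cap_pos[of "int n"]
    by (cases M rule: restrict_to_cases) (auto simp: unew_eq load_Suc held_def)
  define P' where "P' n \<longleftrightarrow> a < n \<and> unew (int n) < \<Delta> (int n)" for n
  define b where "b = (LEAST n. P' n)"
  have unew_y: "unew (int y) < \<Delta> (int y)"
    using last
  proof
    assume "0 < u (int y) \<and> R (\<Delta> (int y)) = \<Delta> (int y)"
    \<comment> \<open>A carrier below capacity gains at least one ball at \<open>y\<close>, so
      \<open>y\<close> is not full after recovery.\<close>
    then show ?thesis
      using load_below_capacity[of y] q_less_y load_nonneg[of y] u_le[of "int y"]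
      by (cases M rule: restrict_to_cases) (auto simp: unew_eq load_Suc held_def ubar_eq)
  next
    assume "u (int y) = 0 \<and> load y = 0"
    then show ?thesis using load_nonneg[of "Suc y"] cap_pos[of "int y"] by (simp add: unew_eq)
  qed
  then have "P' y" using q_less_y a by (simp add: P'_def)
  then have "P' b" "b \<le> y" unfolding b_def by (rule LeastI, rule Least_le)
  then have b: "a < b" "unew (int b) < \<Delta> (int b)" "b \<le> y" by (auto simp: P'_def)
  have before_b: "unew (int n) = \<Delta> (int n)" if "a < n" "n < b" for n
    using not_less_Least[of n P'] that unew_le[of n] by (auto simp: P'_def b_def)
  have "q \<le> b" using full_a[of b] b by (force simp: not_le[symmetric])
  have load0: "load n = 0" if "b < n" "n \<le> y" for n
  proof -
    have "load (Suc b) = 0"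
    proof (cases "b = q")
      \<comment> \<open>The carrier arrives at \<open>q\<close> full. As \<open>q\<close> stays
        below its capacity, the whole load was put down, while the balls of \<open>q\<close> were
        all removed.\<close>
      case True
      then show ?thesis
        using sat[of q] b q_less load_nonneg[of q] u_nonneg[of "int q"]
        by (cases M rule: restrict_to_cases) (auto simp: unew_eq load_Suc held_def ubar_eq)
    next
      case False
      then have "q < b" using \<open>q \<le> b\<close> by simp
      moreover have "u (int b) = 0" using empty[of b] \<open>q < b\<close> that by simp
      moreover have "ubar (int b) < \<Delta> (int b)" using unew_ge[of b] b by simp
      ultimately show ?thesis
        using load_Suc_gap[of b] that by (auto simp: ubar_eq)
    qed
    then show ?thesis using load_zero_until_y[of "Suc b" n] \<open>q \<le> b\<close> that by simp
  qed
  have after_b: "unew (int n) = 0" if "b < n" "n \<le> y" for n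
  proof (cases "n = y")
    case False
    then show ?thesis
      using load0[of n] load0[of "Suc n"] that empty[of n] \<open>q \<le> b\<close> by (simp add: unew_eq)
  next
    \<comment> \<open>Arriving empty, the carrier takes all balls of an up box \<open>y\<close>, and
      none is returned.\<close>
    case True
    then have "load y = 0" using load0[of n] that by simp
    then show ?thesis
      using last True load_after_up_all_released[of y] load_Suc_empty[of y] u_le[of "int y"]
      by (auto simp: unew_eq ubar_eq)
  qed
  \<comment> \<open>For \<open>b = q\<close> the carrier arrives full, with at least
    \<open>\<Delta> (int q)\<close> balls. It fills the vacancies of \<open>q\<close>, and all balls
    of \<open>q\<close> are removed and returned, so \<open>q\<close> would be full.\<close>
  have "q < b" if "R (\<Delta> (int q)) = \<Delta> (int q)"
  proof (rule ccontr)
    assume "\<not> q < b"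
    then have "b = q" using \<open>q \<le> b\<close> by simp
    then show False
      using sat[of q] b q_less load_nonneg[of q] u_nonneg[of "int q"] that
      by (cases M rule: restrict_to_cases) (auto simp: unew_eq load_Suc held_def ubar_eq)
  qed
  moreover have "one_soliton \<Delta> unew x y a b"
    using a b before_a before_b after_b by (simp add: one_soliton_def)
  ultimately show ?thesis using \<open>a \<le> q\<close> by blast
qed

lemma ubar_gap_sum:
  assumes "Suc q \<le> k" "k \<le> y"
  shows "seg_start ubar k - seg_start ubar (Suc q) = load (Suc q) - load k"
  using assms
proof (induction k rule: dec_induct)
  case (step k)
  then show ?case using load_Suc_gap[of k] by simp
qed simp

lemma ubar_sum_eq_held: "seg_start ubar (Suc y) - seg_start ubar q = held q - (load y - ubar (int y))"
  using ubar_gap_sum[of y] q_less_y load_Suc[of q] by simp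

text \<open>Between \<open>q\<close> and \<open>y\<close> the carrier only releases balls, limited
  by its load or by the vacancies; the induction merges the minima.\<close>

lemma ubar_release:
  assumes "Suc q \<le> k" "k \<le> y"
  shows "seg_start ubar k - seg_start ubar (Suc q) = min (load (Suc q))
    ((seg_start \<Delta> k - seg_start u k) - (seg_start \<Delta> (Suc q) - seg_start u (Suc q)))"
  using assms
proof (induction k rule: dec_induct)
  case base
  then show ?case using load_nonneg[of "Suc q"] by simp
next
  case (step k)
  then show ?case using ubar_gap_sum[of k] u_le[of "int k"] ubar_eq[of k] by simp
qed

text \<open>Adds \<open>ubar (int q)\<close> to both arguments of the minimum for the boxes behind
  \<open>q\<close>: the load becomes \<open>held q\<close>, and the vacancies of \<open>q\<close>
  less those left free give the same amount.\<close>

lemma ubar_sum_formula: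
  assumes "R (\<Delta> (int q)) = \<Delta> (int q)"
  shows "seg_start ubar (Suc y) - seg_start ubar q = min
    ((seg_start \<Delta> (Suc y) - seg_start u (Suc y)) - (seg_start \<Delta> q - seg_start u q)
       - max 0 (\<Delta> (int q) - held q)) (held q)"
  using ubar_release[of y] ubar_gap_sum[of y] q_less_y u_le[of "int y"] ubar_eq[of y] load_Suc[of q]
    vacancy_after_size_limit[OF assms]
  by simp

lemma ubar_sum_last:
  assumes "u (int y) = 0" "load y = 0"
  shows "seg_start ubar (Suc y) - seg_start ubar q = held q"
  using ubar_sum_eq_held assms cap_pos[of "int y"] by (simp add: ubar_eq)

end

section \<open>From single stretches to whole states\<close>

lemma soliton_boxes_of_windows:
  assumes "box_state \<Delta> v"
    and win: "\<And>i. i < N \<Longrightarrow> one_soliton \<Delta> v (p i) (p (Suc i)) (a i) (b i)"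
    and before: "\<And>n. n \<le> p 0 \<Longrightarrow> v (int n) = 0"
    and after: "\<And>n. p N < n \<Longrightarrow> v (int n) = 0"
  shows "soliton_boxes \<Delta> v N a b"
proof -
  interpret box_state \<Delta> v by fact
  show ?thesis
  proof
    fix i assume "Suc i < N"
    then have "b i \<le> p (Suc i)" "p (Suc i) < a (Suc i)"
      using win[of i] win[of "Suc i"] by (simp_all add: one_soliton_def)
    then show "b i < a (Suc i)" by simp
  next
    fix n assume n: "v (int n) \<noteq> 0"
    then have "\<not> n \<le> p 0" "n \<le> p N" using before after by (blast, meson not_le)
    then obtain i where i: "i < N" "p i < n" "n \<le> p (Suc i)"
      using ex_least_nat_less[of "\<lambda>k. n \<le> p k" N] by (metis le_refl not_le)
    then show "\<exists>i<N. a i \<le> n \<and> n \<le> b i"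
      using win[of i] n by (metis not_le one_soliton_def)
  qed (use win in \<open>simp_all add: one_soliton_def\<close>)
qed

text \<open>Sums over a soliton thus become sums over its stretch, and the ends \<open>a\<close>,
  \<open>b\<close>, not known explicitly, drop out.\<close>

lemma seg_start_one_soliton:
  assumes "one_soliton \<Delta> v x y a b"
  shows "seg_start v (Suc x) = seg_start v a" "seg_start v (Suc y) = seg_start v (Suc b)"
proof -
  have "seg_start v a = seg_start v (Suc x)" and "seg_start v (Suc y) = seg_start v (Suc b)"
    using assms by (auto simp: one_soliton_def simp del: seg_start_Suc intro!: seg_start_const)
  then show "seg_start v (Suc x) = seg_start v a" "seg_start v (Suc y) = seg_start v (Suc b)"
    by auto
qed

text \<open>Full boxes have no vacancies, so the block can be measured between any cuts
  \<open>m i\<close> inside the solitons. The new states are cut at \<open>m = q\<close>, which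
  avoids their unknown ends.\<close>

lemma (in soliton_boxes) empty_size_between:
  assumes i: "Suc i < N" and m: "p i \<le> m i" "m i < q i" "p (Suc i) \<le> m (Suc i)" "m (Suc i) < q (Suc i)"
  shows "empty_size \<Delta> u (Suc i) = ereal (real_of_int
    ((seg_start \<Delta> (Suc (m (Suc i))) - seg_start u (Suc (m (Suc i))))
      - (seg_start \<Delta> (Suc (m i)) - seg_start u (Suc (m i)))))"
proof -
  have "seg_start u (q i) - seg_start u (Suc (m i)) = seg_start \<Delta> (q i) - seg_start \<Delta> (Suc (m i))"
    using m i full[of i] by (intro seg_start_diff_cong) auto
  moreover have "seg_start u (Suc (m (Suc i))) - seg_start u (Suc (p (Suc i)))
      = seg_start \<Delta> (Suc (m (Suc i))) - seg_start \<Delta> (Suc (p (Suc i)))"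
    using m i full[of "Suc i"] by (intro seg_start_diff_cong) auto
  ultimately show ?thesis unfolding empty_size_eq[OF i] by (simp del: seg_start_Suc)
qed

section \<open>All stretches of a state\<close>

text \<open>\<open>p N\<close> is not an up box but an arbitrary box beyond which there are no balls and the carrier is
  empty, so that the last stretch is treated like the others.\<close>

locale carrier_solitons = carrier \<Delta> u M + soliton_boxes \<Delta> u N p q for \<Delta> u M N p q +
  assumes N_pos: "0 < N"
    and cap: "i < N \<Longrightarrow> restrict_to M (\<Delta> (int (p i))) = \<Delta> (int (p i))"
    and last_gap: "q (N - 1) < p N"
    and after: "p N \<le> n \<Longrightarrow> u (int n) = 0" "p N \<le> n \<Longrightarrow> load n = 0"
begin

lemma load_before:
  assumes "n \<le> p 0"
  shows "load n = 0"
  using load_zero_stays[of 0 n] before_solitons[OF N_pos] assms by simp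

lemma down_less_next: "i < N \<Longrightarrow> q i < p (Suc i)"
  using down_less_up[of i] last_gap by (cases "Suc i < N") (auto dest: Suc_lessI)

lemma window:
  assumes i: "i < N"
  shows "carrier_window \<Delta> u M (p i) (q i) (p (Suc i))"
proof
  show "u (int n) = 0" if "q i < n" "n < p (Suc i)" for n
    using between_solitons[OF i] that by blast
  show "0 < u (int (p (Suc i))) \<and> R (\<Delta> (int (p (Suc i)))) = \<Delta> (int (p (Suc i))) \<or>
    u (int (p (Suc i))) = 0 \<and> load (p (Suc i)) = 0"
  proof (cases "Suc i < N")
    case False
    then have "Suc i = N" using i by simp
    then show ?thesis using after[of "p (Suc i)"] by simp
  qed (use up_pos cap in auto)
qed (use i up_less_down up_pos down_less full cap down_less_next in auto)

lemma load_p0: "load (p 0) = 0"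
  by (simp add: load_before)

lemma ex_ubar_boxes:
  "\<exists>r. soliton_boxes \<Delta> ubar N q r \<and> (\<forall>i<N. one_soliton \<Delta> ubar (p i) (p (Suc i)) (q i) (r i))"
proof -
  have "\<exists>r. one_soliton \<Delta> ubar (p i) (p (Suc i)) (q i) r" if i: "i < N" for i
  proof -
    interpret carrier_window \<Delta> u M "p i" "q i" "p (Suc i)" by (rule window[OF i])
    show ?thesis by (rule ex_one_soliton_ubar)
  qed
  then obtain r where r: "\<And>i. i < N \<Longrightarrow> one_soliton \<Delta> ubar (p i) (p (Suc i)) (q i) (r i)"
    by metis
  moreover have "soliton_boxes \<Delta> ubar N q r"
  proof (rule soliton_boxes_of_windows[where p = p and a = q and b = r, OF _ r])
    show "box_state \<Delta> ubar" using bbs_state_ubar by unfold_locales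
    show "ubar (int n) = 0" if "n \<le> p 0" for n
      using load_before[OF that] u_le[of "int n"] by (simp add: ubar_eq)
    show "ubar (int n) = 0" if "p N < n" for n
      using after[of n] that cap_pos[of "int n"] by (simp add: ubar_eq)
  qed
  ultimately show ?thesis by blast
qed

lemma ex_unew_boxes:
  "\<exists>a b. soliton_boxes \<Delta> unew N a b \<and> (\<forall>i<N. one_soliton \<Delta> unew (p i) (p (Suc i)) (a i) (b i) \<and>
     a i \<le> q i \<and> (R (\<Delta> (int (q i))) = \<Delta> (int (q i)) \<longrightarrow> q i < b i))"
proof -
  have "\<exists>a b. one_soliton \<Delta> unew (p i) (p (Suc i)) a b \<and> a \<le> q i \<and>
      (R (\<Delta> (int (q i))) = \<Delta> (int (q i)) \<longrightarrow> q i < b)" if i: "i < N" for i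
  proof -
    interpret carrier_window \<Delta> u M "p i" "q i" "p (Suc i)" by (rule window[OF i])
    show ?thesis by (rule ex_one_soliton_unew)
  qed
  then obtain a b where ab: "\<And>i. i < N \<Longrightarrow> one_soliton \<Delta> unew (p i) (p (Suc i)) (a i) (b i)"
    "\<And>i. i < N \<Longrightarrow> a i \<le> q i"
    "\<And>i. i < N \<Longrightarrow> R (\<Delta> (int (q i))) = \<Delta> (int (q i)) \<Longrightarrow> q i < b i"
    by metis
  moreover have "soliton_boxes \<Delta> unew N a b"
  proof (rule soliton_boxes_of_windows[where p = p and a = a and b = b, OF _ ab(1)])
    show "box_state \<Delta> unew" using bbs_state_unew by unfold_locales
    show "unew (int n) = 0" if "n \<le> p 0" for n
    proof (cases "n = p 0")
      \<comment> \<open>The carrier reaches the first up box empty and takes all its balls, none of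
        which is removed.\<close>
      case True
      then show ?thesis
        using load_p0 load_after_up_all_released[OF cap[OF N_pos]] u_le[of "int (p 0)"]
        by (simp add: unew_eq ubar_eq)
    next
      case False
      then show ?thesis
        using that load_before[of n] load_before[of "Suc n"] before_solitons[OF N_pos, of n]
        by (simp add: unew_eq)
    qed
    show "unew (int n) = 0" if "p N < n" for n
      using after[of n] after[of "Suc n"] that by (simp add: unew_eq)
  qed
  ultimately show ?thesis by blast
qed

lemma num_solitons_ubar: "num_solitons \<Delta> ubar = N"
  using ex_ubar_boxes soliton_boxes.num_solitons_eq by blast

lemma num_solitons_unew: "num_solitons \<Delta> unew = N"
  using ex_unew_boxes soliton_boxes.num_solitons_eq by blast

lemma soliton_size_ubar:
  assumes "i < N"
  shows "soliton_size \<Delta> ubar i = seg_start ubar (Suc (p (Suc i))) - seg_start ubar (q i)"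
    and "seg_start ubar (Suc (p i)) = seg_start ubar (q i)"
proof -
  obtain r where r: "soliton_boxes \<Delta> ubar N q r"
    "one_soliton \<Delta> ubar (p i) (p (Suc i)) (q i) (r i)"
    using ex_ubar_boxes assms by blast
  show "soliton_size \<Delta> ubar i = seg_start ubar (Suc (p (Suc i))) - seg_start ubar (q i)"
    "seg_start ubar (Suc (p i)) = seg_start ubar (q i)"
    unfolding soliton_boxes.soliton_size_eq[OF r(1) assms] seg_start_one_soliton[OF r(2)] by (rule refl)+
qed

lemma soliton_size_unew:
  assumes "i < N"
  shows "soliton_size \<Delta> unew i = seg_start unew (Suc (p (Suc i))) - seg_start unew (Suc (p i))"
proof -
  obtain a b where ab: "soliton_boxes \<Delta> unew N a b"
    "one_soliton \<Delta> unew (p i) (p (Suc i)) (a i) (b i)"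
    using ex_unew_boxes assms by blast
  show ?thesis
    unfolding soliton_boxes.soliton_size_eq[OF ab(1) assms] seg_start_one_soliton[OF ab(2)] by (rule refl)
qed

lemma empty_size_ubar:
  assumes i: "Suc i < N"
  shows "empty_size \<Delta> ubar (Suc i) = ereal (real_of_int
    ((seg_start \<Delta> (Suc (q (Suc i))) - seg_start ubar (Suc (q (Suc i))))
      - (seg_start \<Delta> (Suc (q i)) - seg_start ubar (Suc (q i)))))"
proof -
  obtain r where r: "soliton_boxes \<Delta> ubar N q r" using ex_ubar_boxes by blast
  then interpret ubar: soliton_boxes \<Delta> ubar N q r .
  show ?thesis using ubar.empty_size_between[OF i, of q] ubar.up_less_down i by simp
qed

lemma empty_size_unew:
  assumes i: "Suc i < N"
    and q: "R (\<Delta> (int (q i))) = \<Delta> (int (q i))" "R (\<Delta> (int (q (Suc i)))) = \<Delta> (int (q (Suc i)))"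
  shows "empty_size \<Delta> unew (Suc i) = ereal (real_of_int
    ((seg_start \<Delta> (Suc (q (Suc i))) - seg_start unew (Suc (q (Suc i))))
      - (seg_start \<Delta> (Suc (q i)) - seg_start unew (Suc (q i)))))"
proof -
  obtain a b where ab: "soliton_boxes \<Delta> unew N a b"
    "\<forall>i<N. a i \<le> q i" "\<forall>i<N. R (\<Delta> (int (q i))) = \<Delta> (int (q i)) \<longrightarrow> q i < b i"
    using ex_unew_boxes by blast
  interpret unew: soliton_boxes \<Delta> unew N a b by fact
  \<comment> \<open>The capacity bounds supply \<open>q i < b i\<close>, which makes
    \<open>q i\<close> an admissible cut.\<close>
  show ?thesis using unew.empty_size_between[OF i, of q] ab(2,3) q i by simp
qed

lemma empty_size_ubar_infinite: "empty_size \<Delta> ubar 0 = \<infinity>" "empty_size \<Delta> ubar N = \<infinity>"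
proof -
  obtain r where r: "soliton_boxes \<Delta> ubar N q r" using ex_ubar_boxes by blast
  then interpret ubar: soliton_boxes \<Delta> ubar N q r .
  show "empty_size \<Delta> ubar 0 = \<infinity>" "empty_size \<Delta> ubar N = \<infinity>"
    using ubar.empty_size_0 ubar.empty_size_N N_pos by auto
qed

section \<open>The evolution equations\<close>

lemma empty_cap_eq: "i < N \<Longrightarrow> empty_cap \<Delta> u (Suc i) = \<Delta> (int (q i))"
  by (simp add: empty_cap_def leftmost_box_empty)

lemma carrier_held_eq: "carrier_held \<Delta> M u (int n) = held n"
  by (simp add: carrier_held_def held_def load_def)

lemma carrier_D_eq: "i < N \<Longrightarrow> carrier_D \<Delta> M u i = held (q i)"
  by (simp add: carrier_D_def leftmost_box_empty carrier_held_eq)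

text \<open>Hence the case distinction in \<open>carrier_C\<close> asks whether the next up box can
  take the whole load.\<close>

lemma carrier_D_minus_size:
  assumes "i < N"
  shows "carrier_D \<Delta> M u i - soliton_size \<Delta> ubar i = load (p (Suc i)) - ubar (int (p (Suc i)))"
  using carrier_window.ubar_sum_eq_held[OF window[OF assms]]
  unfolding soliton_size_ubar(1)[OF assms] carrier_D_eq[OF assms] by linarith

lemma carrier_C_Suc:
  assumes "Suc i < N"
  shows "carrier_C \<Delta> M \<kappa> u (Suc i) = (if ubar (int (p (Suc i))) < load (p (Suc i))
    then held (p (Suc i)) else \<Delta> (int (p (Suc i))))"
  using assms carrier_D_minus_size[of i]
  by (simp add: carrier_C_def num_solitons_eq leftmost_box_soliton carrier_held_eq soliton_cap_eq)

lemma ubar_le_load: "ubar (int n) \<le> load n"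
  by (simp add: ubar_eq)

text \<open>One expression covers all conventions: at index 0, at index \<open>N\<close> and when
  nothing is left over, both sides are 0. As \<kappa> cancels, the equations for soliton sizes and
  \<open>carrier_D\<close> become telescoping sums.\<close>

lemma carrier_C_minus_cap:
  assumes "i \<le> N"
  shows "carrier_C \<Delta> M \<kappa> u i - soliton_cap \<Delta> \<kappa> u i = load (Suc (p i)) - u (int (p i))"
proof (cases "i = N")
  case True
  then show ?thesis
    using after[of "p N"] after[of "Suc (p N)"] by (simp add: carrier_C_def num_solitons_eq)
next
  case False
  then have i: "i < N" using assms by simp
  show ?thesis
  proof (cases i)
    case 0
    then show ?thesis
      using load_after_up_all_released[OF cap[OF i]] load_p0 u_le[of "int (p 0)"]
      by (simp add: carrier_C_def ubar_eq)
  next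
    case (Suc k)
    then show ?thesis
      using i carrier_C_Suc[of k \<kappa>] load_after_up_some_left(1)[of "p i"]
        load_after_up_all_released[OF cap[OF i]] ubar_le_load[of "p i"]
      by (auto simp: soliton_cap_eq)
  qed
qed

lemma carrier_C_formula:
  assumes "i < N" and \<kappa>: "R \<kappa> = \<kappa>"
  shows "carrier_C \<Delta> M \<kappa> u (Suc i) =
    R (carrier_D \<Delta> M u i - soliton_size \<Delta> ubar i + soliton_cap \<Delta> \<kappa> u (Suc i))"
proof (cases "Suc i < N")
  case True
  then show ?thesis
    using carrier_C_Suc[OF True, of \<kappa>] cap[OF True] load_after_up_some_left(2)[of "p (Suc i)"]
      ubar_le_load[of "p (Suc i)"]
    unfolding carrier_D_minus_size[OF \<open>i < N\<close>] by (auto simp: soliton_cap_eq)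
next
  case False
  then have [simp]: "N = Suc i" using assms by simp
  \<comment> \<open>At the last index the carrier is empty and both sides reduce to \<kappa>, which
    is within the capacity.\<close>
  show ?thesis
    unfolding carrier_D_minus_size[OF \<open>i < N\<close>]
    using after[of "p (Suc i)"] cap_pos[of "int (p (Suc i))"] \<kappa>
    by (simp add: carrier_C_def num_solitons_eq soliton_cap_eq ubar_eq)
qed

lemma carrier_D_formula:
  assumes "i < N"
  shows "carrier_D \<Delta> M u i =
    R (carrier_C \<Delta> M \<kappa> u i + soliton_size \<Delta> u i - soliton_cap \<Delta> \<kappa> u i)"
proof -
  have "carrier_C \<Delta> M \<kappa> u i + soliton_size \<Delta> u i - soliton_cap \<Delta> \<kappa> u i =
      load (Suc (p i)) + (seg_start u (Suc (q i)) - seg_start u (Suc (p i)))"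
    using carrier_C_minus_cap[of i \<kappa>] assms by (simp add: soliton_size_eq)
  then show ?thesis
    using carrier_window.held_q[OF window[OF assms]] carrier_D_eq[OF assms] by simp
qed

lemma seg_start_next: "i < N \<Longrightarrow> seg_start u (p (Suc i)) = seg_start u (Suc (q i))"
  using down_less_next[of i] between_solitons[of i] by (intro seg_start_const) auto

lemma soliton_size_unew_formula:
  assumes "i < N"
  shows "soliton_size \<Delta> unew i = soliton_size \<Delta> u i
    + carrier_C \<Delta> M \<kappa> u i - carrier_C \<Delta> M \<kappa> u (Suc i)
    - soliton_cap \<Delta> \<kappa> u i + soliton_cap \<Delta> \<kappa> u (Suc i)"
  using carrier_C_minus_cap[of i \<kappa>] carrier_C_minus_cap[of "Suc i" \<kappa>] assms seg_start_next[OF assms]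
  by (simp add: soliton_size_unew soliton_size_eq seg_start_unew unew_eq)

lemma soliton_size_ubar_formula:
  assumes i: "i < N" and cap_q: "R (\<Delta> (int (q i))) = \<Delta> (int (q i))"
  shows "ereal (real_of_int (soliton_size \<Delta> ubar i)) =
    min (empty_size \<Delta> u (Suc i)
      - ereal (real_of_int (max 0 (empty_cap \<Delta> u (Suc i) - carrier_D \<Delta> M u i))))
      (ereal (real_of_int (carrier_D \<Delta> M u i)))"
proof -
  interpret carrier_window \<Delta> u M "p i" "q i" "p (Suc i)" by (rule window[OF i])
  show ?thesis
  proof (cases "Suc i < N")
    case True
    show ?thesis
      unfolding soliton_size_ubar(1)[OF i] empty_size_eq[OF True] empty_cap_eq[OF i] carrier_D_eq[OF i]
        ubar_sum_formula[OF cap_q]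
      by (simp add: min_def del: seg_start_Suc)
  next
    \<comment> \<open>The last empty block is infinite, so the minimum is its second argument:
      everything held is released.\<close>
    case False
    then have "Suc i = N" using i by simp
    then show ?thesis
      using empty_size_N[OF N_pos] soliton_size_ubar(1)[OF i] ubar_sum_last after[of "p N"]
        carrier_D_eq[OF i] by simp
  qed
qed

text \<open>By \<open>vacancy_after_size_limit\<close> the maxima are the vacancies of
  \<open>q i\<close> and \<open>q (Suc i)\<close> that stay free when \<open>ubar\<close> is added
  to \<open>u\<close>. The rest compares sums of vacancies.\<close>

lemma empty_size_ubar_formula:
  assumes i: "Suc i < N"
    and q: "R (\<Delta> (int (q i))) = \<Delta> (int (q i))" "R (\<Delta> (int (q (Suc i)))) = \<Delta> (int (q (Suc i)))"
  shows "empty_size \<Delta> ubar (Suc i) = empty_size \<Delta> u (Suc i)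
    - ereal (real_of_int (soliton_size \<Delta> ubar i)) + ereal (real_of_int (soliton_size \<Delta> u (Suc i)))
    - ereal (real_of_int (max 0 (empty_cap \<Delta> u (Suc i) - carrier_D \<Delta> M u i)))
    + ereal (real_of_int (max 0 (empty_cap \<Delta> u (Suc (Suc i)) - carrier_D \<Delta> M u (Suc i))))"
proof -
  have i': "i < N" using i by simp
  have "seg_start u (q (Suc i)) - seg_start u (Suc (p (Suc i)))
      = seg_start \<Delta> (q (Suc i)) - seg_start \<Delta> (Suc (p (Suc i)))"
    using full[OF i] up_less_down[OF i] by (intro seg_start_diff_cong) auto
  then show ?thesis
    unfolding empty_size_ubar[OF i] empty_size_eq[OF i] soliton_size_ubar(1)[OF i']
      soliton_size_eq[OF i] empty_cap_eq[OF i'] empty_cap_eq[OF i] carrier_D_eq[OF i'] carrier_D_eq[OF i]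
      vacancy_after_size_limit[OF q(1), symmetric] vacancy_after_size_limit[OF q(2), symmetric]
    using soliton_size_ubar(2)[OF i] seg_start_gap[OF i] by simp
qed

text \<open>Both blocks are cut at the down boxes, so only ball counts differ;
  \<open>load_Suc\<close> at these boxes brings in \<open>carrier_D\<close>.\<close>

lemma empty_size_unew_formula:
  assumes i: "Suc i < N"
    and q: "R (\<Delta> (int (q i))) = \<Delta> (int (q i))" "R (\<Delta> (int (q (Suc i)))) = \<Delta> (int (q (Suc i)))"
  shows "empty_size \<Delta> unew (Suc i) = empty_size \<Delta> ubar (Suc i)
    + ereal (real_of_int (soliton_size \<Delta> ubar i)) - ereal (real_of_int (soliton_size \<Delta> u (Suc i)))
    - ereal (real_of_int (carrier_D \<Delta> M u i)) + ereal (real_of_int (carrier_D \<Delta> M u (Suc i)))"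
proof -
  have i': "i < N" using i by simp
  show ?thesis
    unfolding empty_size_unew[OF assms] empty_size_ubar[OF i] soliton_size_ubar(1)[OF i']
      soliton_size_eq[OF i] carrier_D_eq[OF i'] carrier_D_eq[OF i] seg_start_unew
    using soliton_size_ubar(2)[OF i] seg_start_gap[OF i] load_Suc[of "q i"] load_Suc[of "q (Suc i)"]
    by simp
qed

end

section \<open>Assembly of the result\<close>

lemma ex_carrier_solitons:
  assumes "boxes \<Delta>" "bbs_state \<Delta> u" "num_solitons \<Delta> u = N" "0 < N"
    and cap: "\<And>i. i < N \<Longrightarrow> restrict_to M (soliton_cap \<Delta> \<kappa> u i) = soliton_cap \<Delta> \<kappa> u i"
  obtains p q where "carrier_solitons \<Delta> u M N p q"
proof -
  interpret boxes \<Delta> by fact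
  interpret carrier \<Delta> u M by unfold_locales fact
  obtain N' p q where pq: "soliton_boxes \<Delta> u N' p q" using ex_soliton_boxes[OF state] by blast
  then have [simp]: "N' = N" using assms(3) soliton_boxes.num_solitons_eq by metis
  interpret sol: soliton_boxes \<Delta> u N p q using pq by simp
  obtain L where L: "\<And>n. L \<le> n \<Longrightarrow> u (int n) = 0" "\<And>n. L \<le> n \<Longrightarrow> load n = 0"
    using eventually_empty by blast
  \<comment> \<open>Index \<open>N\<close> has no up box; \<open>p' N\<close> is a box behind the
    last down box from which on there are no balls and no load.\<close>
  define p' where "p' = p(N := max L (Suc (q (N - 1))))"
  have "carrier_solitons \<Delta> u M N p' q"
  proof
    show "restrict_to M (\<Delta> (int (p' i))) = \<Delta> (int (p' i))" if "i < N" for i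
      using cap[OF that] that by (simp add: sol.soliton_cap_eq p'_def)
    show "\<exists>i<N. p' i \<le> n \<and> n \<le> q i" if "u (int n) \<noteq> 0" for n
      using sol.outside[OF that] by (auto simp: p'_def)
  qed (use sol.up_less_down sol.up_pos sol.down_less sol.full sol.down_less_up L \<open>0 < N\<close> in
      \<open>auto simp: p'_def\<close>)
  then show thesis by (rule that)
qed

text \<open>The bound on \<open>K\<close> concerns up boxes and \<kappa>. The equations for
  \<open>Q'\<close>, \<open>E'\<close> and \<open>E (t + 1)\<close> carry bounds on \<Lambda> for
  the down boxes involved; these enter through \<open>vacancy_after_size_limit\<close> and through
  \<open>q i < b i\<close> in \<open>ex_unew_boxes\<close>.\<close>

theorem theorem3:
  fixes \<Delta> :: "int \<Rightarrow> int"
    and M :: "nat \<Rightarrow> enat"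
    and U U' :: "nat \<Rightarrow> int \<Rightarrow> int"
    and \<kappa> :: "nat \<Rightarrow> int"
    and Q Q' K \<Lambda> C' D' :: "nat \<Rightarrow> nat \<Rightarrow> int"
    and E E' :: "nat \<Rightarrow> nat \<Rightarrow> ereal"
    and t N :: nat
  assumes cap_pos: "\<And>n. 0 < \<Delta> n"
    and init: "bbs_state \<Delta> (U 0)"
    and size_limit: "\<And>t. U' (t + 1) = size_limit \<Delta> (M (t + 1)) (U t)"
    and recovery: "\<And>t. U (t + 1) = recovery \<Delta> (M (t + 1)) (U t)"
    and Q: "\<And>t. Q t = soliton_size \<Delta> (U t)"
    and E: "\<And>t. E t = empty_size \<Delta> (U t)"
    and Q': "\<And>t. Q' (t + 1) = soliton_size \<Delta> (U' (t + 1))"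
    and E': "\<And>t. E' (t + 1) = empty_size \<Delta> (U' (t + 1))"
    and K: "\<And>t. K t = soliton_cap \<Delta> (\<kappa> t) (U t)"
    and \<Lambda>: "\<And>t. \<Lambda> t = empty_cap \<Delta> (U t)"
    and C': "\<And>t. C' (t + 1) = carrier_C \<Delta> (M (t + 1)) (\<kappa> t) (U t)"
    and D': "\<And>t. D' (t + 1) = carrier_D \<Delta> (M (t + 1)) (U t)"
    and cap_le: "\<And>t n. n \<le> num_solitons \<Delta> (U t) \<Longrightarrow> ereal (K t n) \<le> ereal_of_enat (M (t + 1))"
    and N: "num_solitons \<Delta> (U t) = N" "1 \<le> N"
  shows "bbs_state \<Delta> (U' (t + 1)) \<and> num_solitons \<Delta> (U' (t + 1)) = N \<and>
    bbs_state \<Delta> (U (t + 1)) \<and> num_solitons \<Delta> (U (t + 1)) = N \<and>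
    (\<forall>n. n \<le> N - 1 \<longrightarrow> ereal (\<Lambda> t (n + 1)) \<le> ereal_of_enat (M (t + 1)) \<longrightarrow>
      ereal (Q' (t + 1) n) =
        min (E t (n + 1) - ereal (max 0 (\<Lambda> t (n + 1) - D' (t + 1) n))) (ereal (D' (t + 1) n))) \<and>
    (\<forall>n. 1 \<le> n \<and> n \<le> N - 1 \<longrightarrow> ereal (\<Lambda> t n) \<le> ereal_of_enat (M (t + 1)) \<longrightarrow>
        ereal (\<Lambda> t (n + 1)) \<le> ereal_of_enat (M (t + 1)) \<longrightarrow>
      E' (t + 1) n =
        E t n - ereal (Q' (t + 1) (n - 1)) + ereal (Q t n)
          - ereal (max 0 (\<Lambda> t n - D' (t + 1) (n - 1)))
          + ereal (max 0 (\<Lambda> t (n + 1) - D' (t + 1) n))) \<and>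
    (\<forall>n. 1 \<le> n \<and> n \<le> N \<longrightarrow>
      ereal (C' (t + 1) n) =
        min (ereal (D' (t + 1) (n - 1) - Q' (t + 1) (n - 1) + K t n)) (ereal_of_enat (M (t + 1)))) \<and>
    (\<forall>n. n \<le> N - 1 \<longrightarrow>
      ereal (D' (t + 1) n) =
        min (ereal (C' (t + 1) n + Q t n - K t n)) (ereal_of_enat (M (t + 1)))) \<and>
    (\<forall>n. n \<le> N - 1 \<longrightarrow>
      Q (t + 1) n = Q t n + C' (t + 1) n - C' (t + 1) (n + 1) - K t n + K t (n + 1)) \<and>
    (\<forall>n. 1 \<le> n \<and> n \<le> N - 1 \<longrightarrow> ereal (\<Lambda> t n) \<le> ereal_of_enat (M (t + 1)) \<longrightarrow>
        ereal (\<Lambda> t (n + 1)) \<le> ereal_of_enat (M (t + 1)) \<longrightarrow>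
      E (t + 1) n =
        E' (t + 1) n + ereal (Q' (t + 1) (n - 1)) - ereal (Q t n)
          - ereal (D' (t + 1) (n - 1)) + ereal (D' (t + 1) n)) \<and>
    E t 0 = \<infinity> \<and> E t N = \<infinity> \<and> E' (t + 1) 0 = \<infinity> \<and> E' (t + 1) N = \<infinity> \<and>
    C' (t + 1) 0 = K t 0"
proof -
  interpret boxes \<Delta> by unfold_locales (rule cap_pos)
  have states: "bbs_state \<Delta> (U k)" for k
  proof (induction k)
    case 0
    show ?case by (rule init)
  next
    case (Suc k)
    then interpret carrier \<Delta> "U k" "M (k + 1)" by unfold_locales
    show ?case using bbs_state_unew recovery[of k] by simp
  qed
  define u where "u = U t"
  define m where "m = M (t + 1)"
  define k where "k = \<kappa> t"
  have t: "Q t = soliton_size \<Delta> u" "E t = empty_size \<Delta> u" "K t = soliton_cap \<Delta> k u" "\<Lambda> t = empty_cap \<Delta> u"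
    "U' (t + 1) = size_limit \<Delta> m u" "U (t + 1) = recovery \<Delta> m u" "M (t + 1) = m"
    "Q' (t + 1) = soliton_size \<Delta> (size_limit \<Delta> m u)" "E' (t + 1) = empty_size \<Delta> (size_limit \<Delta> m u)"
    "Q (t + 1) = soliton_size \<Delta> (recovery \<Delta> m u)" "E (t + 1) = empty_size \<Delta> (recovery \<Delta> m u)"
    "C' (t + 1) = carrier_C \<Delta> m k u" "D' (t + 1) = carrier_D \<Delta> m u"
    using size_limit recovery Q E Q' E' K \<Lambda> C' D' by (simp_all add: u_def m_def k_def)
  have cap_K: "restrict_to m (soliton_cap \<Delta> k u i) = soliton_cap \<Delta> k u i" if "i \<le> N" for i
    using cap_le[of i t] that N t by (simp add: restrict_to_fixed_iff u_def)
  have "0 < N" using N by simp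
  obtain p q where "carrier_solitons \<Delta> u m N p q"
    by (rule ex_carrier_solitons[where \<kappa> = k])
      (use states[of t] N \<open>0 < N\<close> cap_K boxes_axioms in \<open>auto simp: u_def\<close>)
  then interpret carrier_solitons \<Delta> u m N p q .
  \<comment> \<open>The bound on \<open>K\<close> includes index \<open>N\<close>, where
    \<open>soliton_cap\<close> takes the conventional value.\<close>
  have k: "restrict_to m k = k" using cap_K[of N] by (simp add: soliton_cap_eq)
  have \<Lambda>_le: "restrict_to m (\<Delta> (int (q i))) = \<Delta> (int (q i))"
    if "ereal (empty_cap \<Delta> u (Suc i)) \<le> ereal_of_enat m" "i < N" for i
    using that by (simp add: restrict_to_fixed_iff empty_cap_eq)
  have pred: "n - 1 < N" "Suc (n - 1) = n" if "1 \<le> n \<and> n \<le> N" for n using that by auto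
  show ?thesis
    unfolding t
  proof (intro conjI allI impI)
    fix n assume n: "n \<le> N - 1" and cap_q: "ereal (empty_cap \<Delta> u (n + 1)) \<le> ereal_of_enat m"
    then have "n < N" using \<open>0 < N\<close> by simp
    from soliton_size_ubar_formula[OF this \<Lambda>_le[OF _ this]] cap_q
    show "ereal (soliton_size \<Delta> (size_limit \<Delta> m u) n) =
        min (empty_size \<Delta> u (n + 1) - ereal (max 0 (empty_cap \<Delta> u (n + 1) - carrier_D \<Delta> m u n)))
          (ereal (carrier_D \<Delta> m u n))"
      by simp
  next
    fix n assume n: "1 \<le> n \<and> n \<le> N - 1"
      and cap_q: "ereal (empty_cap \<Delta> u n) \<le> ereal_of_enat m" "ereal (empty_cap \<Delta> u (n + 1)) \<le> ereal_of_enat m"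
    then obtain i where i: "n = Suc i" "Suc i < N" by (cases n) auto
    then have q: "restrict_to m (\<Delta> (int (q i))) = \<Delta> (int (q i))"
      "restrict_to m (\<Delta> (int (q (Suc i)))) = \<Delta> (int (q (Suc i)))"
      using cap_q \<Lambda>_le[of i] \<Lambda>_le[of "Suc i"] by simp_all
    show "empty_size \<Delta> (size_limit \<Delta> m u) n = empty_size \<Delta> u n
        - ereal (soliton_size \<Delta> (size_limit \<Delta> m u) (n - 1)) + ereal (soliton_size \<Delta> u n)
        - ereal (max 0 (empty_cap \<Delta> u n - carrier_D \<Delta> m u (n - 1)))
        + ereal (max 0 (empty_cap \<Delta> u (n + 1) - carrier_D \<Delta> m u n))"
      using empty_size_ubar_formula[OF i(2) q] i by simp
    show "empty_size \<Delta> (recovery \<Delta> m u) n = empty_size \<Delta> (size_limit \<Delta> m u) n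
        + ereal (soliton_size \<Delta> (size_limit \<Delta> m u) (n - 1)) - ereal (soliton_size \<Delta> u n)
        - ereal (carrier_D \<Delta> m u (n - 1)) + ereal (carrier_D \<Delta> m u n)"
      using empty_size_unew_formula[OF i(2) q] i by simp
  next
    fix n assume "1 \<le> n \<and> n \<le> N"
    then show "ereal (carrier_C \<Delta> m k u n) =
        min (ereal (carrier_D \<Delta> m u (n - 1) - soliton_size \<Delta> (size_limit \<Delta> m u) (n - 1)
          + soliton_cap \<Delta> k u n)) (ereal_of_enat m)"
      using carrier_C_formula[OF _ k, of "n - 1"] pred by (simp add: restrict_to_eq_min)
  next
    fix n assume "n \<le> N - 1"
    then have n: "n < N" using \<open>0 < N\<close> by simp
    show "ereal (carrier_D \<Delta> m u n) =
        min (ereal (carrier_C \<Delta> m k u n + soliton_size \<Delta> u n - soliton_cap \<Delta> k u n)) (ereal_of_enat m)"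
      using carrier_D_formula[OF n, of k] by (simp add: restrict_to_eq_min)
    show "soliton_size \<Delta> (recovery \<Delta> m u) n = soliton_size \<Delta> u n + carrier_C \<Delta> m k u n
        - carrier_C \<Delta> m k u (n + 1) - soliton_cap \<Delta> k u n + soliton_cap \<Delta> k u (n + 1)"
      using soliton_size_unew_formula[OF n] by simp
  qed (use bbs_state_ubar bbs_state_unew num_solitons_ubar num_solitons_unew empty_size_0 empty_size_N
      empty_size_ubar_infinite \<open>0 < N\<close> in \<open>simp_all add: carrier_C_def\<close>)
qed

end
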